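(* Let $K$ be a field of characteristic zero and let $K[X_1,X_2,X_3,X_4]$ be the polynomial ring in four variables over $K$. Let $D$ be a locally nilpotent $K$-derivation of $K[X_1,X_2,X_3,X_4]$ such that $D$ is irreducible, $DX_1=0$, and $D^{2}X_i=0$ for $i=2,3,4$. Then $\operatorname{Ker} D=K^{[3]}$.
   Context: For a ring $S$ and an $S$-algebra $C$, $C=S^{[n]}$ means that $C$ is isomorphic, as an $S$-algebra, to a polynomial ring in $n$ variables over $S$. A derivation $D$ of $B$ is locally nilpotent if for each $b\in B$ there is $n$ with $D^n b=0$. $D$ is reducible if there is a non-unit $b\in B$ with $DB\subseteq bB$, and irreducible otherwise. *)

theory Defs
  imports Complex_Main "HOL-Library.Poly_Mapping" "HOL-Library.Numeral_Type"
begin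

text \<open>
  The polynomial ring over \<open>'k\<close> with variables indexed by \<open>'n\<close>: finitely supported
  coefficient functions on exponent vectors, with the convolution product of
  \<^theory>\<open>HOL-Library.Poly_Mapping\<close>.
\<close>

type_synonym ('n, 'k) mpoly = "('n \<Rightarrow>\<^sub>0 nat) \<Rightarrow>\<^sub>0 'k"

definition Const :: "'k::comm_ring_1 \<Rightarrow> ('n, 'k) mpoly"
  where "Const c = Poly_Mapping.single 0 c"

definition Var :: "'n \<Rightarrow> ('n, 'k::comm_ring_1) mpoly"
  where "Var i = Poly_Mapping.single (Poly_Mapping.single i 1) 1"

text \<open>
  Arithmetic in the index type \<^typ>\<open>4\<close> is modulo 4, so that \<open>4 = 0\<close> there; the numerals
  1, 2, 3, 4 thus name its four elements, each once.
\<close>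

lemma index_UNIV_4: "(UNIV :: 4 set) = {1, 2, 3, 4}"
  and index_distinct_4: "distinct [1, 2, 3, 4 :: 4]"
proof -
  show d: "distinct [1, 2, 3, 4 :: 4]"
    by simp
  have "card {1, 2, 3, 4 :: 4} = CARD(4)"
    using distinct_card[OF d] by simp
  then show "(UNIV :: 4 set) = {1, 2, 3, 4}"
    by (metis card_subset_eq finite subset_UNIV)
qed

definition K_derivation :: "(('n, 'k::comm_ring_1) mpoly \<Rightarrow> ('n, 'k) mpoly) \<Rightarrow> bool"
  where "K_derivation D \<longleftrightarrow>
    (\<forall>a b. D (a + b) = D a + D b) \<and>
    (\<forall>a b. D (a * b) = D a * b + a * D b) \<and>
    (\<forall>c. D (Const c) = 0)"

definition locally_nilpotent :: "('b::zero \<Rightarrow> 'b) \<Rightarrow> bool"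
  where "locally_nilpotent D \<longleftrightarrow> (\<forall>b. \<exists>n. (D ^^ n) b = 0)"

definition reducible_derivation :: "('b::comm_ring_1 \<Rightarrow> 'b) \<Rightarrow> bool"
  where "reducible_derivation D \<longleftrightarrow> (\<exists>b. \<not> b dvd 1 \<and> range D \<subseteq> range (\<lambda>x. b * x))"

abbreviation irreducible_derivation :: "('b::comm_ring_1 \<Rightarrow> 'b) \<Rightarrow> bool"
  where "irreducible_derivation D \<equiv> \<not> reducible_derivation D"

definition Ker :: "('b::zero \<Rightarrow> 'b) \<Rightarrow> 'b set"
  where "Ker D = {b. D b = 0}"

definition K_algebra_hom :: "(('m, 'k::comm_ring_1) mpoly \<Rightarrow> ('n, 'k) mpoly) \<Rightarrow> bool"
  where "K_algebra_hom \<phi> \<longleftrightarrow>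
    (\<forall>a b. \<phi> (a + b) = \<phi> a + \<phi> b) \<and>
    (\<forall>a b. \<phi> (a * b) = \<phi> a * \<phi> b) \<and>
    (\<forall>c. \<phi> (Const c) = Const c)"

text \<open>
  \<open>A = K\<^sup>[\<^sup>m\<^sup>]\<close> for a subalgebra \<open>A\<close> of a polynomial ring over \<open>K\<close>, where \<open>m\<close> is the number of
  elements of the index type \<open>'m\<close>. That \<open>A\<close> is a subalgebra is implied, as \<open>A\<close> is the image
  of \<open>\<phi>\<close>; unitality of \<open>\<phi>\<close> is the case \<open>c = 1\<close> of its \<open>K\<close>-linearity.
\<close>

definition is_polynomial_algebra :: "'m::finite itself \<Rightarrow> ('n, 'k::comm_ring_1) mpoly set \<Rightarrow> bool"
  where "is_polynomial_algebra (_ :: 'm itself) A \<longleftrightarrow>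
    (\<exists>\<phi> :: ('m, 'k) mpoly \<Rightarrow> ('n, 'k) mpoly. K_algebra_hom \<phi> \<and> bij_betw \<phi> UNIV A)"

end

theory Submission
  imports Defs "HOL-Computational_Algebra.Computational_Algebra" "HOL-Computational_Algebra.Field_as_Ring"
begin

text \<open>
  Write \<open>w\<^sub>i = D X\<^sub>i\<close>. Since \<open>D w\<^sub>i = 0\<close>, the homomorphism \<open>X\<^sub>i \<mapsto> X\<^sub>i + \<lambda> w\<^sub>i\<close> is the flow of \<open>D\<close>, and
  every \<open>q\<close> with \<open>D q = 0\<close> satisfies \<open>q (X + \<lambda> w) = q\<close> (\<open>quasi_transl_flow_kernel\<close>). If such a \<open>q\<close>
  has positive degree in \<open>X\<^sub>2, X\<^sub>3, X\<^sub>4\<close>, the highest power of \<open>\<lambda>\<close> shows that its top form vanishes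
  at \<open>w\<close> (\<open>replace_vars_top_eq_0\<close>). As the \<open>w\<^sub>i\<close> themselves lie in the kernel, this yields homogeneous
  algebraic relations between them, over \<open>R = K[X\<^sub>1]\<close>.

  A homogeneous relation between only two polynomials forces their quotient into the fraction field
  of \<open>R\<close>, which is algebraically closed in the field of rational functions
  (\<open>two_variable_relation\<close>). To reach this case from three variables, let \<open>t\<^sub>i\<close> be the
  components of \<open>w\<^sub>i\<close> of the common maximal degree. They again define a derivation that kills all
  \<open>t\<^sub>i\<close>. Divide them by a common factor of maximal degree. The coprime quotients are themselves
  relations between the quotients, unless they lie in \<open>R\<close>. If no relation omitted one of the three
  variables, all relations would have a nonconstant factor in common
  (\<open>prime_ideal_common_factor\<close>), contradicting coprimality. Hence \<open>t\<close> is proportional to a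
  vector \<open>c\<close> with entries in \<open>R\<close> (\<open>homogeneous_quasi_transl_commensurable\<close>; this is the
  theorem of Gordan and Noether in three variables). A top form \<open>t\<^sub>z\<close> is then invariant under
  translation along \<open>c\<close>, so that one variable can be eliminated from the relation \<open>t\<^sub>z (w) = 0\<close>,
  and the two-variable case makes \<open>w\<^sub>2, w\<^sub>3, w\<^sub>4\<close> linearly dependent over \<open>R\<close>
  (\<open>quasi_transl_linear_relation\<close>).

  The ring \<open>R\<close> is Euclidean, so elementary changes of coordinates turn this linear relation into
  \<open>w\<^sub>l = 0\<close> for one \<open>l\<close> (\<open>polynomial_kernel_of_relation\<close>). Only two variables \<open>X\<^sub>i, X\<^sub>j\<close> still
  move, over \<open>S = K[X\<^sub>1, X\<^sub>l]\<close>. By the two-variable case once more, and by irreducibility,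
  \<open>f = D X\<^sub>i\<close> and \<open>g = D X\<^sub>j\<close> are coprime elements of \<open>S\<close>. The kernel is then \<open>S[g X\<^sub>i - f X\<^sub>j]\<close>:
  if \<open>D q = 0\<close>, the partial derivatives of \<open>q\<close> are \<open>g r\<close> and \<open>- f r\<close> for some \<open>r\<close> in the kernel
  of smaller degree, and \<open>q\<close> is recovered from \<open>r\<close> by integration (\<open>kernel_coprime\<close>).
\<close>

section \<open>Ring homomorphisms and twisted derivations of polynomial rings\<close>

lemma poly_mapping_add_induct [case_names zero add]:
  assumes "P 0" and "\<And>f k v. P f \<Longrightarrow> P (f + Poly_Mapping.single k v)"
  shows "P (f :: 'a \<Rightarrow>\<^sub>0 'b::comm_monoid_add)"
proof (induction f rule: update_induct)
  case const
  show ?case by (rule assms(1))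
next
  case (update f a b)
  have "Poly_Mapping.update a b f = f + Poly_Mapping.single a b"
    using update by (intro poly_mapping_eqI)
      (auto simp: lookup_update lookup_add lookup_single when_def in_keys_iff)
  with assms(2) update show ?case by metis
qed

definition ring_hom :: "('a::comm_ring_1 \<Rightarrow> 'b::comm_ring_1) \<Rightarrow> bool"
  where "ring_hom h \<longleftrightarrow> h 1 = 1 \<and> (\<forall>a b. h (a + b) = h a + h b) \<and> (\<forall>a b. h (a * b) = h a * h b)"

lemma ring_homI:
  assumes "h 1 = 1" "\<And>a b. h (a + b) = h a + h b" "\<And>a b. h (a * b) = h a * h b"
  shows "ring_hom h"
  using assms by (auto simp: ring_hom_def)

lemma ring_hom_simps:
  assumes "ring_hom h"
  shows "h 1 = 1" "h (a + b) = h a + h b" "h (a * b) = h a * h b" "h 0 = 0" "h (- a) = - h a"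
    "h (a - b) = h a - h b" "h (a ^ n) = h a ^ n" "h (sum f A) = (\<Sum>i\<in>A. h (f i))"
proof -
  show 1: "h 1 = 1" and add: "\<And>a b. h (a + b) = h a + h b" and mult: "\<And>a b. h (a * b) = h a * h b"
    using assms by (auto simp: ring_hom_def)
  show zero: "h 0 = 0" using add[of 0 0] by simp
  show minus: "\<And>a. h (- a) = - h a" using add zero by (metis add.right_inverse add_eq_0_iff)
  show "h (a - b) = h a - h b" using add[of a "- b"] minus by simp
  show "h (a ^ n) = h a ^ n" by (induction n) (simp_all add: 1 mult)
  show "h (sum f A) = (\<Sum>i\<in>A. h (f i))"
    by (induction A rule: infinite_finite_induct) (simp_all add: zero add)
qed

lemma ring_hom_comp: "ring_hom f \<Longrightarrow> ring_hom g \<Longrightarrow> ring_hom (\<lambda>x. f (g x))"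
  by (simp add: ring_hom_def)

lemma ring_hom_id: "ring_hom (\<lambda>x. x)"
  by (simp add: ring_hom_def)

lemma ring_hom_map_poly:
  assumes "ring_hom h"
  shows "ring_hom (map_poly h)"
  by (rule ring_homI)
    (simp_all add: poly_eq_iff coeff_map_poly coeff_mult ring_hom_simps[OF assms])

lemma ring_hom_poly: "ring_hom (\<lambda>p. poly p x)"
  by (simp add: ring_hom_def)

lemma ring_hom_pCons: "ring_hom (\<lambda>c. [:c:])"
  by (auto intro!: ring_homI simp: one_pCons)

lemma ring_hom_Const: "ring_hom Const"
  by (auto intro!: ring_homI simp: Const_def single_add mult_single)

definition eval_mpoly_monom :: "('n \<Rightarrow> 'b::comm_ring_1) \<Rightarrow> ('n \<Rightarrow>\<^sub>0 nat) \<Rightarrow> 'b"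
  where "eval_mpoly_monom v m = (\<Prod>i\<in>Poly_Mapping.keys m. v i ^ Poly_Mapping.lookup m i)"

text \<open>
  The coefficient homomorphism \<open>h\<close> is a parameter because values are taken in several algebras: in
  polynomial rings, in univariate polynomials over them, and in iterated univariate polynomials.
\<close>

definition eval_mpoly :: "('k::comm_ring_1 \<Rightarrow> 'b::comm_ring_1) \<Rightarrow> ('n \<Rightarrow> 'b) \<Rightarrow> ('n, 'k) mpoly \<Rightarrow> 'b"
  where "eval_mpoly h v p = (\<Sum>m\<in>Poly_Mapping.keys p. h (Poly_Mapping.lookup p m) * eval_mpoly_monom v m)"

lemma eval_mpoly_monom_superset:
  assumes "finite A" "Poly_Mapping.keys m \<subseteq> A"
  shows "eval_mpoly_monom v m = (\<Prod>i\<in>A. v i ^ Poly_Mapping.lookup m i)"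
  unfolding eval_mpoly_monom_def using assms
  by (intro prod.mono_neutral_left) (auto simp: in_keys_iff)

lemma eval_mpoly_monom_add: "eval_mpoly_monom v (m + n) = eval_mpoly_monom v m * eval_mpoly_monom v n"
proof -
  let ?A = "Poly_Mapping.keys m \<union> Poly_Mapping.keys n"
  have "eval_mpoly_monom v (m + n) = (\<Prod>i\<in>?A. v i ^ Poly_Mapping.lookup (m + n) i)"
    by (intro eval_mpoly_monom_superset) (auto simp: Poly_Mapping.keys_add)
  also have "\<dots> = (\<Prod>i\<in>?A. v i ^ Poly_Mapping.lookup m i) * (\<Prod>i\<in>?A. v i ^ Poly_Mapping.lookup n i)"
    by (simp add: lookup_add power_add prod.distrib)
  also have "\<dots> = eval_mpoly_monom v m * eval_mpoly_monom v n"
    by (simp add: eval_mpoly_monom_superset[symmetric])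
  finally show ?thesis .
qed

context
  fixes h :: "'k::comm_ring_1 \<Rightarrow> 'b::comm_ring_1" and v :: "'n \<Rightarrow> 'b"
  assumes h: "ring_hom h"
begin

lemma eval_mpoly_superset:
  assumes "finite A" "Poly_Mapping.keys p \<subseteq> A"
  shows "eval_mpoly h v p = (\<Sum>m\<in>A. h (Poly_Mapping.lookup p m) * eval_mpoly_monom v m)"
  unfolding eval_mpoly_def using assms
  by (intro sum.mono_neutral_left) (auto simp: in_keys_iff ring_hom_simps[OF h])

lemma eval_mpoly_add: "eval_mpoly h v (p + q) = eval_mpoly h v p + eval_mpoly h v q"
proof -
  let ?A = "Poly_Mapping.keys p \<union> Poly_Mapping.keys q"
  have "eval_mpoly h v (p + q) = (\<Sum>m\<in>?A. h (Poly_Mapping.lookup (p + q) m) * eval_mpoly_monom v m)"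
    by (intro eval_mpoly_superset) (auto simp: Poly_Mapping.keys_add)
  also have "\<dots> = (\<Sum>m\<in>?A. h (Poly_Mapping.lookup p m) * eval_mpoly_monom v m)
      + (\<Sum>m\<in>?A. h (Poly_Mapping.lookup q m) * eval_mpoly_monom v m)"
    by (simp add: lookup_add ring_hom_simps[OF h] distrib_right sum.distrib)
  also have "\<dots> = eval_mpoly h v p + eval_mpoly h v q"
    by (simp add: eval_mpoly_superset[symmetric])
  finally show ?thesis .
qed

lemma eval_mpoly_single: "eval_mpoly h v (Poly_Mapping.single m c) = h c * eval_mpoly_monom v m"
  by (subst eval_mpoly_superset[where A = "{m}"]) auto

lemma eval_mpoly_Const: "eval_mpoly h v (Const c) = h c"
  by (simp add: Const_def eval_mpoly_single eval_mpoly_monom_def)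

lemma eval_mpoly_Var: "eval_mpoly h v (Var i) = v i"
  by (simp add: Var_def eval_mpoly_single ring_hom_simps[OF h] eval_mpoly_monom_superset[where A = "{i}"])

lemma eval_mpoly_0: "eval_mpoly h v 0 = 0"
  by (simp add: eval_mpoly_def)

lemma eval_mpoly_mult_single: "eval_mpoly h v (p * Poly_Mapping.single m c) = eval_mpoly h v p * eval_mpoly h v (Poly_Mapping.single m c)"
proof (induction p rule: poly_mapping_add_induct)
  case zero
  show ?case by (simp add: eval_mpoly_0)
next
  case (add f k c')
  have "eval_mpoly h v (Poly_Mapping.single k c' * Poly_Mapping.single m c)
      = eval_mpoly h v (Poly_Mapping.single k c') * eval_mpoly h v (Poly_Mapping.single m c)"
    by (simp add: eval_mpoly_single mult_single eval_mpoly_monom_add ring_hom_simps[OF h])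
  with add show ?case
    by (simp add: distrib_right eval_mpoly_add)
qed

lemma eval_mpoly_mult: "eval_mpoly h v (p * q) = eval_mpoly h v p * eval_mpoly h v q"
  by (induction q rule: poly_mapping_add_induct)
    (simp_all add: distrib_left eval_mpoly_add eval_mpoly_mult_single eval_mpoly_0)

lemma ring_hom_eval_mpoly: "ring_hom (eval_mpoly h v)"
  using eval_mpoly_Const[of 1] h
    by (intro ring_homI eval_mpoly_add eval_mpoly_mult) (simp add: Const_def ring_hom_simps)

end

text \<open>
  Polynomials are generated by constants and variables under sums and products. This induction
  avoids monomials altogether, and properties of all homogeneous components can be proved with it.
\<close>

lemma mpoly_induct [case_names Const Var add mult]:
  assumes Const: "\<And>c. P (Const c)" and Var: "\<And>i. P (Var i)"
    and add: "\<And>p q. P p \<Longrightarrow> P q \<Longrightarrow> P (p + q)" and mult: "\<And>p q. P p \<Longrightarrow> P q \<Longrightarrow> P (p * q)"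
  shows "P (p :: ('n, 'k::comm_ring_1) mpoly)"
proof -
  have one: "P 1" using Const[of 1] by (simp add: Const_def)
  have pow: "P (Poly_Mapping.single (Poly_Mapping.single i n) 1)" for i n
  proof (induction n)
    case (Suc n)
    have "(Poly_Mapping.single (Poly_Mapping.single i (Suc n)) 1 :: ('n, 'k) mpoly)
        = Poly_Mapping.single (Poly_Mapping.single i n) 1 * Var i"
      by (simp add: Var_def mult_single single_add[symmetric])
    with Suc mult Var show ?case by metis
  qed (use one in simp)
  have monom: "P (Poly_Mapping.single m 1)" for m
  proof (induction m rule: poly_mapping_add_induct)
    case (add f k n)
    have "(Poly_Mapping.single (f + Poly_Mapping.single k n) 1 :: ('n, 'k) mpoly)
        = Poly_Mapping.single f 1 * Poly_Mapping.single (Poly_Mapping.single k n) 1"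
      by (simp add: mult_single)
    with add mult pow show ?case by metis
  qed (use one in simp)
  show ?thesis
  proof (induction p rule: poly_mapping_add_induct)
    case zero
    show ?case using Const[of 0] by (simp add: Const_def)
  next
    case (add f m c)
    have "Poly_Mapping.single m c = Const c * Poly_Mapping.single m 1"
      by (simp add: Const_def mult_single)
    with add monom mult Const assms(3) show ?case by metis
  qed
qed

lemma ring_hom_eqI:
  assumes "ring_hom F" "ring_hom G" "\<And>c. F (Const c) = G (Const c)" "\<And>i. F (Var i) = G (Var i)"
  shows "F p = G p"
  by (induction p rule: mpoly_induct)
    (simp_all add: assms(3,4) ring_hom_simps[OF assms(1)] ring_hom_simps[OF assms(2)])

text \<open>
  Identities between derivatives and substitutions are obtained below by checking them on the
  variables: both sides are derivations with respect to the same homomorphism \<open>h\<close>.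
\<close>

definition twisted_deriv :: "(('a::comm_ring_1) \<Rightarrow> 'b::comm_ring_1) \<Rightarrow> ('a \<Rightarrow> 'b) \<Rightarrow> bool"
  where "twisted_deriv h d \<longleftrightarrow> (\<forall>a b. d (a + b) = d a + d b) \<and> (\<forall>a b. d (a * b) = d a * h b + h a * d b)"

lemma twisted_deriv_eqI:
  assumes "twisted_deriv h F" "twisted_deriv h G" "\<And>c. F (Const c) = G (Const c)" "\<And>i. F (Var i) = G (Var i)"
  shows "F p = G p"
  using assms by (induction p rule: mpoly_induct) (auto simp: twisted_deriv_def)

lemma twisted_derivI:
  assumes "\<And>a b. d (a + b) = d a + d b" "\<And>a b. d (a * b) = d a * h b + h a * d b"
  shows "twisted_deriv h d"
  using assms by (simp add: twisted_deriv_def)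

lemma twisted_deriv_simps:
  assumes "twisted_deriv h d"
  shows "d (a + b) = d a + d b" "d (a * b) = d a * h b + h a * d b" "d 0 = 0" "d (- a) = - d a"
    "d (a - b) = d a - d b" "d (sum f A) = (\<Sum>i\<in>A. d (f i))"
proof -
  show add: "\<And>a b. d (a + b) = d a + d b" and mult: "d (a * b) = d a * h b + h a * d b"
    using assms by (auto simp: twisted_deriv_def)
  show zero: "d 0 = 0" using add[of 0 0] by simp
  show minus: "\<And>a. d (- a) = - d a" using add zero by (metis add.right_inverse add_eq_0_iff)
  show "d (a - b) = d a - d b" using add[of a "- b"] minus by simp
  show "d (sum f A) = (\<Sum>i\<in>A. d (f i))"
    by (induction A rule: infinite_finite_induct) (simp_all add: zero add)
qed

lemma twisted_deriv_map_poly: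
  assumes "twisted_deriv (\<lambda>x. x) d"
  shows "twisted_deriv (\<lambda>x. x) (map_poly d)"
  by (rule twisted_derivI)
    (simp_all add: poly_eq_iff coeff_map_poly coeff_mult twisted_deriv_simps[OF assms] sum.distrib)

lemma twisted_deriv_pderiv: "twisted_deriv (\<lambda>x. x) (pderiv :: 'a::idom poly \<Rightarrow> _)"
  by (rule twisted_derivI) (simp_all add: pderiv_add pderiv_mult)

lemma twisted_deriv_comp: "twisted_deriv (\<lambda>x. x) d \<Longrightarrow> ring_hom h \<Longrightarrow> twisted_deriv h (\<lambda>p. d (h p))"
  by (simp add: twisted_deriv_def ring_hom_def)

lemma twisted_deriv_comp2: "twisted_deriv (\<lambda>x. x) d \<Longrightarrow> ring_hom h \<Longrightarrow> twisted_deriv h (\<lambda>p. h (d p))"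
  by (simp add: twisted_deriv_def ring_hom_def)

lemma twisted_deriv_cmult: "twisted_deriv h d \<Longrightarrow> twisted_deriv h (\<lambda>p. c * d p)"
  by (simp add: twisted_deriv_def algebra_simps)

abbreviation subst :: "('n \<Rightarrow> ('m, 'k) mpoly) \<Rightarrow> ('n, 'k::comm_ring_1) mpoly \<Rightarrow> ('m, 'k) mpoly"
  where "subst \<equiv> eval_mpoly Const"

abbreviation psubst :: "('n \<Rightarrow> ('m, 'k) mpoly poly) \<Rightarrow> ('n, 'k::comm_ring_1) mpoly \<Rightarrow> ('m, 'k) mpoly poly"
  where "psubst \<equiv> eval_mpoly (\<lambda>c. [:Const c:])"

lemmas subst_simps [simp] = ring_hom_simps[OF ring_hom_eval_mpoly[OF ring_hom_Const]] eval_mpoly_Const[OF ring_hom_Const] eval_mpoly_Var[OF ring_hom_Const]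

lemma ring_hom_pConst: "ring_hom (\<lambda>c. [:Const c:])"
  by (rule ring_hom_comp[OF ring_hom_pCons ring_hom_Const])

lemmas psubst_simps [simp] = ring_hom_simps[OF ring_hom_eval_mpoly[OF ring_hom_pConst]] eval_mpoly_Const[OF ring_hom_pConst] eval_mpoly_Var[OF ring_hom_pConst]

lemma subst_subst: "subst v (subst w p) = subst (\<lambda>i. subst v (w i)) p"
  by (rule ring_hom_eqI[where F = "\<lambda>p. subst v (subst w p)"])
    (auto intro: ring_hom_comp ring_hom_eval_mpoly ring_hom_Const)

lemma map_subst_psubst: "map_poly (subst v) (psubst w p) = psubst (\<lambda>i. map_poly (subst v) (w i)) p"
  by (rule ring_hom_eqI[where F = "\<lambda>p. map_poly (subst v) (psubst w p)"])
    (auto intro: ring_hom_comp ring_hom_eval_mpoly ring_hom_Const ring_hom_pConst ring_hom_map_poly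
      simp: map_poly_pCons)

lemma poly_psubst: "poly (psubst w p) x = subst (\<lambda>i. poly (w i) x) p"
  by (rule ring_hom_eqI[where F = "\<lambda>p. poly (psubst w p) x"])
    (auto intro: ring_hom_comp[OF ring_hom_poly] ring_hom_eval_mpoly ring_hom_Const ring_hom_pConst)

lemma subst_Var: "subst Var p = p"
  by (rule ring_hom_eqI[where F = "subst Var"])
    (auto intro: ring_hom_id ring_hom_eval_mpoly ring_hom_Const)

section \<open>Greatest common divisors in four variables\<close>

text \<open>
  A copy of a field that carries the trivial Euclidean structure, in which every nonzero element
  divides every other. With it, univariate polynomial rings, iterated four times, have gcds.
\<close>

typedef 'a gcd_field = "UNIV :: 'a set" ..

setup_lifting type_definition_gcd_field

instantiation gcd_field :: (field) field
begin
lift_definition zero_gcd_field :: "'a gcd_field" is 0 .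
lift_definition one_gcd_field :: "'a gcd_field" is 1 .
lift_definition plus_gcd_field :: "'a gcd_field \<Rightarrow> 'a gcd_field \<Rightarrow> 'a gcd_field" is "(+)" .
lift_definition minus_gcd_field :: "'a gcd_field \<Rightarrow> 'a gcd_field \<Rightarrow> 'a gcd_field" is "(-)" .
lift_definition times_gcd_field :: "'a gcd_field \<Rightarrow> 'a gcd_field \<Rightarrow> 'a gcd_field" is "(*)" .
lift_definition uminus_gcd_field :: "'a gcd_field \<Rightarrow> 'a gcd_field" is uminus .
lift_definition inverse_gcd_field :: "'a gcd_field \<Rightarrow> 'a gcd_field" is inverse .
lift_definition divide_gcd_field :: "'a gcd_field \<Rightarrow> 'a gcd_field \<Rightarrow> 'a gcd_field" is "(/)" .
instance by standard (transfer; simp add: field_simps; fail)+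
end

instantiation gcd_field :: (field) "{unique_euclidean_ring, normalization_euclidean_semiring, normalization_semidom_multiplicative}"
begin
definition [simp]: "normalize_gcd_field = (normalize_field :: 'a gcd_field \<Rightarrow> _)"
definition [simp]: "unit_factor_gcd_field = (unit_factor_field :: 'a gcd_field \<Rightarrow> _)"
definition [simp]: "modulo_gcd_field = (mod_field :: 'a gcd_field \<Rightarrow> _)"
definition [simp]: "euclidean_size_gcd_field = (euclidean_size_field :: 'a gcd_field \<Rightarrow> _)"
definition [simp]: "division_segment (x :: 'a gcd_field) = 1"
instance
  by standard (simp_all add: dvd_field_iff field_split_simps split: if_splits)
end

instantiation gcd_field :: (field) euclidean_ring_gcd
begin
definition gcd_gcd_field :: "'a gcd_field \<Rightarrow> 'a gcd_field \<Rightarrow> 'a gcd_field"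
  where "gcd_gcd_field = Euclidean_Algorithm.gcd"
definition lcm_gcd_field :: "'a gcd_field \<Rightarrow> 'a gcd_field \<Rightarrow> 'a gcd_field"
  where "lcm_gcd_field = Euclidean_Algorithm.lcm"
definition Gcd_gcd_field :: "'a gcd_field set \<Rightarrow> 'a gcd_field"
  where "Gcd_gcd_field = Euclidean_Algorithm.Gcd"
definition Lcm_gcd_field :: "'a gcd_field set \<Rightarrow> 'a gcd_field"
  where "Lcm_gcd_field = Euclidean_Algorithm.Lcm"
instance by standard
  (simp_all add: gcd_gcd_field_def lcm_gcd_field_def Gcd_gcd_field_def Lcm_gcd_field_def)
end

instance gcd_field :: (field) field_gcd ..

definition lift_hom :: "('a::comm_ring_1 \<Rightarrow> 'b::comm_ring_1) \<Rightarrow> 'b \<Rightarrow> 'a poly \<Rightarrow> 'b"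
  where "lift_hom h x p = poly (map_poly h p) x"

lemma ring_hom_lift_hom: "ring_hom h \<Longrightarrow> ring_hom (lift_hom h x)"
  unfolding lift_hom_def by (intro ring_hom_comp[OF ring_hom_poly] ring_hom_map_poly)

lemma lift_hom_simps:
  assumes "ring_hom h"
  shows "lift_hom h x [:c:] = h c" "lift_hom h x [:0, 1:] = x"
  by (simp_all add: lift_hom_def map_poly_pCons ring_hom_simps[OF assms])

lemma poly_ring_hom_eqI:
  assumes "ring_hom F" "ring_hom G" "F [:0, 1:] = G [:0, 1:]" "\<And>c. F [:c:] = G [:c:]"
  shows "F p = G p"
proof (induction p)
  case (pCons a p)
  have "pCons a p = [:a:] + [:0, 1:] * p" by simp
  then show ?case
    by (simp only: ring_hom_simps[OF assms(1)] ring_hom_simps[OF assms(2)] pCons.IH assms(3,4))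
qed (simp add: ring_hom_simps[OF assms(1)] ring_hom_simps[OF assms(2)])

text \<open>
  Coprimality in the form of Euclid's lemma, which refers to divisibility only and is therefore
  carried along by ring isomorphisms.
\<close>

definition coprime_split :: "'a::comm_ring_1 \<Rightarrow> 'a \<Rightarrow> bool"
  where "coprime_split a b \<longleftrightarrow> (\<forall>c. a dvd b * c \<longrightarrow> a dvd c) \<and> (\<forall>c. b dvd a * c \<longrightarrow> b dvd c)"

lemma gcd_factorization:
  fixes a b :: "'a::factorial_ring_gcd"
  assumes "a \<noteq> 0 \<or> b \<noteq> 0"
  shows "\<exists>d a' b'. a = d * a' \<and> b = d * b' \<and> coprime_split a' b'"
proof -
  obtain a' b' where *: "a = a' * gcd a b" "b = b' * gcd a b" "coprime a' b'"
    using gcd_coprime_exists[of a b] assms by auto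
  then have "coprime_split a' b'"
    by (auto simp: coprime_split_def coprime_dvd_mult_right_iff coprime_commute)
  with * show ?thesis by (metis mult.commute)
qed

type_synonym 'k iter4 = "'k gcd_field poly poly poly poly"

lemma ring_hom_Abs_gcd_field: "ring_hom Abs_gcd_field"
  by (rule ring_homI; transfer) auto

lemma ring_hom_Rep_gcd_field: "ring_hom Rep_gcd_field"
  by (rule ring_homI; transfer) auto

lemma forall_4: "(\<forall>i::4. P i) \<longleftrightarrow> P 1 \<and> P 2 \<and> P 3 \<and> P 4"
  using index_UNIV_4 by (metis UNIV_I empty_iff insert_iff)

text \<open>
  The ring in four variables is isomorphic to the ring of four times iterated univariate polynomials,
  and the factorization is transported along this isomorphism.
\<close>

lemma mpoly_gcd_factorization:
  fixes a b :: "(4, 'k::field) mpoly"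
  assumes "a \<noteq> 0 \<or> b \<noteq> 0"
  shows "\<exists>d a' b'. a = d * a' \<and> b = d * b' \<and> coprime_split a' b'"
proof -
  define h :: "'k \<Rightarrow> 'k iter4" where "h = (\<lambda>c. [:[:[:[:Abs_gcd_field c:]:]:]:])"
  define v :: "4 \<Rightarrow> 'k iter4" where "v = (\<lambda>i. if i = 1 then [:0, 1:] else if i = 2 then [:[:0, 1:]:]
    else if i = 3 then [:[:[:0, 1:]:]:] else [:[:[:[:0, 1:]:]:]:])"
  define F where "F = eval_mpoly h v"
  define G :: "'k iter4 \<Rightarrow> (4, 'k) mpoly"
    where "G = lift_hom (lift_hom (lift_hom (lift_hom (\<lambda>c. Const (Rep_gcd_field c))
     (Var 4)) (Var 3)) (Var 2)) (Var 1)"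
  note G_ring_hom = ring_hom_comp[OF ring_hom_Const ring_hom_Rep_gcd_field] ring_hom_lift_hom
  have h: "ring_hom h" unfolding h_def
    by (intro ring_hom_comp[OF ring_hom_pCons] ring_hom_Abs_gcd_field)
  have F: "ring_hom F" unfolding F_def by (rule ring_hom_eval_mpoly[OF h])
  have G: "ring_hom G" unfolding G_def by (intro G_ring_hom)
  have Fc: "F (Const c) = [:[:[:[:Abs_gcd_field c:]:]:]:]" for c
    unfolding F_def eval_mpoly_Const[OF h] by (simp add: h_def)
  have Fv: "F (Var i) = v i" for i
    unfolding F_def by (rule eval_mpoly_Var[OF h])
  have GF: "G (F p) = p" for p
  proof (rule ring_hom_eqI[where F = "\<lambda>p. G (F p)"])
    show "ring_hom (\<lambda>p. G (F p))" by (rule ring_hom_comp[OF G F])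
    show "G (F (Const c)) = Const c" for c
      by (simp add: Fc G_def lift_hom_simps G_ring_hom Abs_gcd_field_inverse)
    have "\<forall>i. G (F (Var i)) = Var i"
      by (simp add: forall_4 Fv v_def G_def lift_hom_simps G_ring_hom)
    then show "G (F (Var i)) = Var i" for i by blast
  qed (rule ring_hom_id)
  note FG_ring_hom = ring_hom_comp[OF F G]
  note c2 = ring_hom_comp[OF ring_hom_pCons ring_hom_pCons]
  note c3 = ring_hom_comp[OF ring_hom_pCons c2]
  note gen = G_def lift_hom_simps G_ring_hom Fv Fc v_def Rep_gcd_field_inverse
  \<comment> \<open>Homomorphisms on univariate polynomials agree if they agree on constants and on the indeterminate;
    this is applied to one layer of the iterated ring at a time, beginning with the innermost.\<close>
  have FG3: "F (G [:[:[:c:]:]:]) = [:[:[:c:]:]:]" for c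
    by (rule poly_ring_hom_eqI[OF ring_hom_comp[OF FG_ring_hom c3] c3]) (simp_all add: gen)
  have FG2: "F (G [:[:c:]:]) = [:[:c:]:]" for c
    by (rule poly_ring_hom_eqI[OF ring_hom_comp[OF FG_ring_hom c2] c2 _ FG3]) (simp add: gen)
  have FG1: "F (G [:c:]) = [:c:]" for c
    by (rule poly_ring_hom_eqI[OF ring_hom_comp[OF FG_ring_hom ring_hom_pCons] ring_hom_pCons _ FG2])
      (simp add: gen)
  have FG: "F (G q) = q" for q
    by (rule poly_ring_hom_eqI[OF FG_ring_hom ring_hom_id _ FG1]) (simp add: gen)
  have F_mult: "F (x * y) = F x * F y" for x y by (rule ring_hom_simps(3)[OF F])
  have G_mult: "G (x * y) = G x * G y" for x y by (rule ring_hom_simps(3)[OF G])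
  have dvd: "x dvd y \<longleftrightarrow> F x dvd F y" for x y
  proof
    assume "F x dvd F y"
    then obtain c where "F y = F x * c" by (rule dvdE)
    then have "G (F y) = G (F x) * G c" by (simp only: G_mult)
    then show "x dvd y" unfolding GF by (rule dvdI)
  next
    assume "x dvd y"
    then obtain c where "y = x * c" by (rule dvdE)
    then have "F y = F x * F c" by (simp only: F_mult)
    then show "F x dvd F y" by (rule dvdI)
  qed
  have "F a \<noteq> 0 \<or> F b \<noteq> 0"
  proof (rule ccontr)
    assume "\<not> ?thesis"
    then have "G (F a) = 0" "G (F b) = 0" by (simp_all add: ring_hom_simps(4)[OF G])
    with assms show False unfolding GF by blast
  qed
  from gcd_factorization[OF this] obtain d a' b'
    where *: "F a = d * a'" "F b = d * b'" "coprime_split a' b'"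
    by blast
  have "G (F a) = G d * G a'" "G (F b) = G d * G b'"
    unfolding *(1,2) G_mult by (rule refl)+
  then have "a = G d * G a'" "b = G d * G b'"
    unfolding GF .
  moreover have "coprime_split (G a') (G b')"
    using *(3) unfolding coprime_split_def dvd F_mult FG by blast
  ultimately show ?thesis by blast
qed

section \<open>Gradings, derivations and the flow of a quasi-translation\<close>

lemma eval_mpoly_subst:
  assumes "ring_hom h"
  shows "eval_mpoly h v (subst w p) = eval_mpoly h (\<lambda>i. eval_mpoly h v (w i)) p"
  by (rule ring_hom_eqI[where F = "\<lambda>p. eval_mpoly h v (subst w p)"])
    (auto intro: ring_hom_comp[OF ring_hom_eval_mpoly[OF assms]] ring_hom_eval_mpoly ring_hom_Const assms
      simp: eval_mpoly_Const[OF assms] eval_mpoly_Var[OF assms])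

definition set_zero :: "'n set \<Rightarrow> ('n, 'k::comm_ring_1) mpoly \<Rightarrow> ('n, 'k) mpoly"
  where "set_zero N = subst (\<lambda>i. if i \<in> N then 0 else Var i)"

text \<open>
  Not involving the variables in \<open>N\<close> is expressed by invariance under setting them to zero, so that
  the closure properties follow from those of a ring homomorphism.
\<close>

definition free_of :: "'n set \<Rightarrow> ('n, 'k::comm_ring_1) mpoly \<Rightarrow> bool"
  where "free_of N p \<longleftrightarrow> set_zero N p = p"

text \<open>
  Multiplying the variables in \<open>N\<close> by an indeterminate \<open>\<lambda>\<close> encodes the grading by the degree in
  \<open>N\<close>: the homogeneous components of a polynomial are the coefficients of its image, its degree in
  \<open>N\<close> is the degree of its image, and its top form is the leading coefficient.
\<close>

definition scale_vars :: "'n set \<Rightarrow> ('n, 'k::comm_ring_1) mpoly \<Rightarrow> ('n, 'k) mpoly poly"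
  where "scale_vars N = psubst (\<lambda>i. if i \<in> N then monom (Var i) 1 else [:Var i:])"

definition homogeneous :: "'n set \<Rightarrow> nat \<Rightarrow> ('n, 'k::comm_ring_1) mpoly \<Rightarrow> bool"
  where "homogeneous N n p \<longleftrightarrow> scale_vars N p = monom p n"

lemma ring_hom_set_zero: "ring_hom (set_zero N)" and ring_hom_scale_vars: "ring_hom (scale_vars N)"
  by (simp_all add: set_zero_def scale_vars_def ring_hom_eval_mpoly ring_hom_Const ring_hom_pConst)

lemmas set_zero_simps [simp] = ring_hom_simps[OF ring_hom_set_zero]
lemmas scale_vars_simps [simp] = ring_hom_simps[OF ring_hom_scale_vars]

lemma set_zero_Const [simp]: "set_zero N (Const c) = Const c"
  and set_zero_Var [simp]: "set_zero N (Var i) = (if i \<in> N then 0 else Var i)"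
  and scale_vars_Const [simp]: "scale_vars N (Const c) = [:Const c:]"
  and scale_vars_Var [simp]: "scale_vars N (Var i) = (if i \<in> N then monom (Var i) 1 else [:Var i:])"
  by (simp_all add: set_zero_def scale_vars_def)

lemma poly_scale_vars_1: "poly (scale_vars N p) 1 = p"
  by (rule ring_hom_eqI[where F = "\<lambda>p. poly (scale_vars N p) 1"])
    (auto intro: ring_hom_comp[OF ring_hom_poly] ring_hom_scale_vars ring_hom_id simp: poly_monom)

lemma poly_scale_vars_0: "poly (scale_vars N p) 0 = set_zero N p"
  by (rule ring_hom_eqI[where F = "\<lambda>p. poly (scale_vars N p) 0"])
    (auto intro: ring_hom_comp[OF ring_hom_poly] ring_hom_scale_vars ring_hom_set_zero
      simp: poly_monom)

lemma scale_vars_set_zero: "scale_vars N (set_zero N p) = [:set_zero N p:]"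
  by (rule ring_hom_eqI[where F = "\<lambda>p. scale_vars N (set_zero N p)"])
    (auto intro: ring_hom_comp[OF ring_hom_scale_vars] ring_hom_comp[OF ring_hom_pCons] ring_hom_set_zero)

lemma free_of_iff_scale_vars: "free_of N p \<longleftrightarrow> scale_vars N p = [:p:]"
  unfolding free_of_def using scale_vars_set_zero[of N p] poly_scale_vars_0[of N p] by auto

lemma free_of_iff_degree: "free_of N p \<longleftrightarrow> degree (scale_vars N p) = 0"
  unfolding free_of_iff_scale_vars using poly_scale_vars_1[of N p] by (auto elim!: degree_eq_zeroE)

lemma free_of_iff_homogeneous: "free_of N p \<longleftrightarrow> homogeneous N 0 p"
  by (simp add: free_of_iff_scale_vars homogeneous_def monom_0)

lemma scale_vars_eq_0_iff [simp]: "scale_vars N p = 0 \<longleftrightarrow> p = 0"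
  using poly_scale_vars_1[of N p] by auto

lemma free_of_intros [simp, intro]:
  "free_of N (Const c)" "free_of N 0" "free_of N 1" "i \<notin> N \<Longrightarrow> free_of N (Var i)"
  "free_of N p \<Longrightarrow> free_of N q \<Longrightarrow> free_of N (p + q)" "free_of N p \<Longrightarrow> free_of N q \<Longrightarrow> free_of N (p - q)"
  "free_of N p \<Longrightarrow> free_of N q \<Longrightarrow> free_of N (p * q)" "free_of N p \<Longrightarrow> free_of N (- p)" "free_of N p \<Longrightarrow> free_of N (p ^ n)"
  by (simp_all add: free_of_def)

lemma free_of_sum: "(\<And>i. i \<in> A \<Longrightarrow> free_of N (f i)) \<Longrightarrow> free_of N (sum f A)"
  by (simp add: free_of_def)

lemma free_of_set_zero: "free_of N (set_zero N p)"
  by (simp add: free_of_iff_degree scale_vars_set_zero)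

lemma set_zero_set_zero: "M \<subseteq> N \<Longrightarrow> set_zero M (set_zero N p) = set_zero N p"
  by (rule ring_hom_eqI[where F = "\<lambda>p. set_zero M (set_zero N p)"])
    (auto intro: ring_hom_comp[OF ring_hom_set_zero] ring_hom_set_zero)

lemma free_of_mono: "free_of N p \<Longrightarrow> M \<subseteq> N \<Longrightarrow> free_of M p"
  unfolding free_of_def using set_zero_set_zero by metis

text \<open>
  Degrees add up under multiplication, so factors of a polynomial of degree \<open>0\<close> in \<open>N\<close> have degree
  \<open>0\<close>.
\<close>

lemma free_of_factor:
  fixes p q :: "('n::linorder, 'k::idom) mpoly"
  assumes "free_of N (p * q)" "p * q \<noteq> 0"
  shows "free_of N p"
  using assms by (simp add: free_of_iff_degree degree_mult_eq)

lemma free_of_eval_mpoly_cong: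
  assumes "free_of N p" "ring_hom h" "\<And>i. i \<notin> N \<Longrightarrow> v i = w i"
  shows "eval_mpoly h v p = eval_mpoly h w p"
proof -
  have *: "eval_mpoly h u p = eval_mpoly h (\<lambda>i. if i \<in> N then 0 else u i) p" for u
  proof -
    have "eval_mpoly h u p = eval_mpoly h u (set_zero N p)" using assms(1)
      by (simp add: free_of_def)
    also have "\<dots> = eval_mpoly h (\<lambda>i. if i \<in> N then 0 else u i) p"
      unfolding set_zero_def eval_mpoly_subst[OF assms(2)]
      by (rule arg_cong[where f = "\<lambda>v. eval_mpoly h v p"])
        (auto simp: eval_mpoly_Var[OF assms(2)] ring_hom_simps[OF ring_hom_eval_mpoly[OF assms(2)]])
    finally show ?thesis .
  qed
  have "(\<lambda>i. if i \<in> N then 0 else v i) = (\<lambda>i. if i \<in> N then 0 else w i)"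
    using assms(3) by auto
  then show ?thesis unfolding *[of v] *[of w] by (rule arg_cong)
qed

lemma free_of_subst_id: 
  assumes "free_of N p" "\<And>i. i \<notin> N \<Longrightarrow> v i = Var i"
  shows "subst v p = p"
  using free_of_eval_mpoly_cong[OF assms(1) ring_hom_Const, of v Var] assms(2)
    by (simp add: subst_Var)

lemma homogeneous_coeff_scale_vars: "homogeneous N n (coeff (scale_vars N p) n)"
proof (induction p arbitrary: n rule: mpoly_induct)
  case (Const c)
  show ?case by (cases n) (simp_all add: homogeneous_def monom_0)
next
  case (Var i)
  show ?case
    by (cases n) (auto simp: homogeneous_def monom_0 coeff_monom coeff_pCons split: nat.splits)
next
  case (add p q)
  then show ?case by (simp add: homogeneous_def add_monom)
next
  case (mult p q)
  then show ?case
    by (simp add: homogeneous_def coeff_mult mult_monom monom_sum)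
qed

lemma scale_vars_set_zero_commute: "scale_vars N (set_zero M p) = map_poly (set_zero M) (scale_vars N p)"
  by (rule ring_hom_eqI[where F = "\<lambda>p. scale_vars N (set_zero M p)"])
    (auto intro: ring_hom_comp[OF ring_hom_map_poly[OF ring_hom_set_zero]] ring_hom_comp[OF ring_hom_scale_vars] ring_hom_scale_vars ring_hom_set_zero
      simp: map_poly_pCons map_poly_monom)

lemma free_of_coeff_scale_vars:
  assumes "free_of M p"
  shows "free_of M (coeff (scale_vars N p) n)"
  using scale_vars_set_zero_commute[of N M p] assms unfolding free_of_def
  by (metis coeff_map_poly set_zero_simps(4))

lemma homogeneous_set_zero: "homogeneous N n p \<Longrightarrow> homogeneous N n (set_zero M p)"
  by (simp add: homogeneous_def scale_vars_set_zero_commute map_poly_monom)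

lemma sum_coeff_scale_vars:
  assumes "degree (scale_vars N p) \<le> m"
  shows "p = (\<Sum>n\<le>m. coeff (scale_vars N p) n)"
proof -
  have "p = (\<Sum>n\<le>degree (scale_vars N p). coeff (scale_vars N p) n)"
    using poly_scale_vars_1[of N p] by (simp add: poly_altdef)
  also have "\<dots> = (\<Sum>n\<le>m. coeff (scale_vars N p) n)"
    by (rule sum.mono_neutral_left) (use assms in \<open>auto intro: coeff_eq_0\<close>)
  finally show ?thesis .
qed

lemma eval_mpoly_scale_vars:
  assumes h: "ring_hom h" and "\<And>i. i \<in> N \<Longrightarrow> v i = c * w i" "\<And>i. i \<notin> N \<Longrightarrow> v i = w i"
  shows "eval_mpoly h v p = poly (map_poly (eval_mpoly h w) (scale_vars N p)) c"
proof (rule ring_hom_eqI[where F = "eval_mpoly h v"])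
  show "ring_hom (\<lambda>p. poly (map_poly (eval_mpoly h w) (scale_vars N p)) c)"
    by (rule ring_hom_comp[OF ring_hom_poly ring_hom_comp[OF ring_hom_map_poly[OF ring_hom_eval_mpoly[OF h]] ring_hom_scale_vars]])
  have 0: "eval_mpoly h w 0 = 0" by (rule eval_mpoly_0[OF h])
  show "eval_mpoly h v (Const x) = poly (map_poly (eval_mpoly h w) (scale_vars N (Const x))) c" for x
    by (simp add: map_poly_pCons eval_mpoly_Const[OF h] 0)
  show "eval_mpoly h v (Var i) = poly (map_poly (eval_mpoly h w) (scale_vars N (Var i))) c" for i
    by (simp add: map_poly_pCons map_poly_monom poly_monom eval_mpoly_Var[OF h] assms(2,3) 0)
qed (rule ring_hom_eval_mpoly[OF h])

lemma eval_mpoly_homogeneous: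
  assumes "homogeneous N n s" "ring_hom h" "\<And>i. i \<in> N \<Longrightarrow> v i = c * w i" "\<And>i. i \<notin> N \<Longrightarrow> v i = w i"
  shows "eval_mpoly h v s = c ^ n * eval_mpoly h w s"
proof -
  have "eval_mpoly h v s = poly (map_poly (eval_mpoly h w) (scale_vars N s)) c"
    using assms(2-) by (rule eval_mpoly_scale_vars)
  also have "map_poly (eval_mpoly h w) (scale_vars N s) = monom (eval_mpoly h w s) n"
    using assms(1) by (simp add: homogeneous_def map_poly_monom eval_mpoly_0[OF assms(2)])
  finally show ?thesis by (simp add: poly_monom mult.commute)
qed

text \<open>
  The first-order Taylor expansion of \<open>p\<close> at \<open>X + \<lambda> w\<close> is \<open>p + \<lambda> \<Sum>\<^sub>i w\<^sub>i \<partial>\<^sub>i p\<close>. Reading the derivation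
  with prescribed values \<open>w\<^sub>i\<close> off this homomorphism gives the Leibniz rule at once.
\<close>

definition flow :: "('n \<Rightarrow> ('n, 'k::comm_ring_1) mpoly) \<Rightarrow> ('n, 'k) mpoly \<Rightarrow> ('n, 'k) mpoly poly"
  where "flow w = psubst (\<lambda>i. [:Var i, w i:])"

definition deriv_along :: "('n \<Rightarrow> ('n, 'k::comm_ring_1) mpoly) \<Rightarrow> ('n, 'k) mpoly \<Rightarrow> ('n, 'k) mpoly"
  where "deriv_along w p = coeff (flow w p) 1"

lemma ring_hom_flow: "ring_hom (flow w)"
  by (simp add: flow_def ring_hom_eval_mpoly ring_hom_pConst)

lemmas flow_simps [simp] = ring_hom_simps[OF ring_hom_flow]

lemma flow_Const [simp]: "flow w (Const c) = [:Const c:]"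
  and flow_Var [simp]: "flow w (Var i) = [:Var i, w i:]"
  by (simp_all add: flow_def)

lemma coeff_flow_0: "coeff (flow w p) 0 = p"
proof -
  have "poly (flow w p) 0 = p"
    by (rule ring_hom_eqI[where F = "\<lambda>p. poly (flow w p) 0"])
      (auto intro: ring_hom_comp[OF ring_hom_poly] ring_hom_flow ring_hom_id)
  then show ?thesis by (simp add: poly_0_coeff_0)
qed

lemma twisted_deriv_deriv_along: "twisted_deriv (\<lambda>x. x) (deriv_along w)"
  by (rule twisted_derivI) (simp_all add: deriv_along_def coeff_mult coeff_flow_0 algebra_simps)

lemmas deriv_along_simps [simp] = twisted_deriv_simps[OF twisted_deriv_deriv_along]

lemma deriv_along_Const [simp]: "deriv_along w (Const c) = 0"
  and deriv_along_Var [simp]: "deriv_along w (Var i) = w i"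
  by (simp_all add: deriv_along_def)

lemma deriv_along_1 [simp]: "deriv_along w 1 = 0"
  using deriv_along_Const[of w 1] by (simp add: Const_def)

lemma deriv_along_cmult: "deriv_along (\<lambda>i. a * w i) p = a * deriv_along w p"
  by (rule twisted_deriv_eqI[where F = "deriv_along (\<lambda>i. a * w i)"])
    (auto intro: twisted_deriv_deriv_along twisted_deriv_cmult)

lemma K_derivation_eq_deriv_along:
  assumes "K_derivation D"
  shows "D = deriv_along (\<lambda>i. D (Var i))"
proof
  have "twisted_deriv (\<lambda>x. x) D"
    using assms by (auto simp: twisted_deriv_def K_derivation_def)
  then show "D p = deriv_along (\<lambda>i. D (Var i)) p" for p
    by (rule twisted_deriv_eqI[OF _ twisted_deriv_deriv_along])
      (use assms in \<open>auto simp: K_derivation_def\<close>)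
qed

lemma deriv_along_free_of:
  assumes "free_of N p" "\<And>i. i \<notin> N \<Longrightarrow> w i = 0"
  shows "deriv_along w p = 0"
proof -
  have "flow w p = psubst (\<lambda>i. [:Var i:]) p"
    unfolding flow_def using assms by (intro free_of_eval_mpoly_cong ring_hom_pConst) auto
  also have "\<dots> = [:p:]"
    by (rule ring_hom_eqI[where F = "psubst (\<lambda>i. [:Var i:])"])
      (auto intro: ring_hom_eval_mpoly ring_hom_pConst ring_hom_pCons)
  finally show ?thesis by (simp add: deriv_along_def)
qed

text \<open>
  For the derivation \<open>D\<close> with values \<open>w\<^sub>i\<close> this says \<open>D\<^sup>2 X\<^sub>i = 0\<close>; the map \<open>X \<mapsto> X + w\<close> is then called a
  quasi-translation, as its inverse is \<open>X \<mapsto> X - w\<close>.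
\<close>

definition quasi_transl :: "('n \<Rightarrow> ('n, 'k::comm_ring_1) mpoly) \<Rightarrow> bool"
  where "quasi_transl w \<longleftrightarrow> (\<forall>i. deriv_along w (w i) = 0)"

text \<open>
  This is the differential equation of the flow of \<open>D\<close>. It holds on variables: there the left side
  is \<open>D X\<^sub>i + \<lambda> D\<^sup>2 X\<^sub>i = w\<^sub>i\<close>, and the right side is the derivative of \<open>X\<^sub>i + \<lambda> w\<^sub>i\<close>.
\<close>

lemma quasi_transl_pderiv_flow:
  fixes w :: "'n::linorder \<Rightarrow> ('n, 'k::idom) mpoly"
  assumes "quasi_transl w"
  shows "map_poly (deriv_along w) (flow w p) = pderiv (flow w p)"
proof (rule twisted_deriv_eqI[where F = "\<lambda>p. map_poly (deriv_along w) (flow w p)"])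
  show "twisted_deriv (flow w) (\<lambda>p. map_poly (deriv_along w) (flow w p))"
    by (rule twisted_deriv_comp[OF twisted_deriv_map_poly[OF twisted_deriv_deriv_along] ring_hom_flow])
  show "twisted_deriv (flow w) (\<lambda>p. pderiv (flow w p))"
    by (rule twisted_deriv_comp[OF twisted_deriv_pderiv ring_hom_flow])
qed (use assms in \<open>auto simp: map_poly_pCons pderiv_pCons quasi_transl_def\<close>)

text \<open>
  By the differential equation, \<open>D\<close> maps the coefficient of \<open>\<lambda>\<^sup>n\<close> to \<open>n + 1\<close> times the next one, so
  in characteristic zero all coefficients vanish once the first-order one does.
\<close>

lemma quasi_transl_flow_kernel:
  fixes w :: "'n::linorder \<Rightarrow> ('n, 'k::{idom,ring_char_0}) mpoly"
  assumes "quasi_transl w" "deriv_along w p = 0"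
  shows "flow w p = [:p:]"
proof -
  have *: "deriv_along w (coeff (flow w p) n) = of_nat (Suc n) * coeff (flow w p) (Suc n)" for n
    using arg_cong[OF quasi_transl_pderiv_flow[OF assms(1), of p], of "\<lambda>q. coeff q n"]
    by (simp add: coeff_map_poly coeff_pderiv del: of_nat_Suc)
  have "coeff (flow w p) (Suc n) = 0" for n
  proof (induction n)
    case 0
    show ?case using assms(2) by (simp add: deriv_along_def)
  next
    case (Suc n)
    with *[of "Suc n"] have "of_nat (Suc (Suc n)) * coeff (flow w p) (Suc (Suc n)) = 0" by simp
    then show ?case by (simp del: of_nat_Suc)
  qed
  then show ?thesis
    by (intro poly_eqI) (auto simp: coeff_flow_0 coeff_pCons split: nat.splits)
qed

text \<open>
  The kernel of \<open>D\<close> is factorially closed: it consists of the polynomials on which the flow has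
  degree \<open>0\<close> in \<open>\<lambda>\<close>, and this degree is additive.
\<close>

lemma quasi_transl_kernel_factor:
  fixes w :: "'n::linorder \<Rightarrow> ('n, 'k::{idom,ring_char_0}) mpoly"
  assumes "quasi_transl w" "deriv_along w (p * q) = 0" "p * q \<noteq> 0"
  shows "deriv_along w p = 0"
proof -
  have nz: "flow w p \<noteq> 0" "flow w q \<noteq> 0"
    using assms(3) coeff_flow_0 by (metis coeff_0 mult_zero_left, metis coeff_0 mult_zero_right)
  have "degree (flow w p * flow w q) = 0"
    using quasi_transl_flow_kernel[OF assms(1,2)] by simp
  with nz have "degree (flow w p) = 0" by (simp add: degree_mult_eq)
  then show ?thesis by (simp add: deriv_along_def coeff_eq_0)
qed

lemma coeff_mult_degree_le:
  assumes "degree p \<le> a" "degree q \<le> b"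
  shows "coeff (p * q) (a + b) = coeff p a * coeff q b"
proof -
  have "coeff (p * q) (a + b) = (\<Sum>i\<le>a + b. coeff p i * coeff q (a + b - i))"
    by (simp add: coeff_mult)
  also have "\<dots> = (\<Sum>i\<in>{a}. coeff p i * coeff q (a + b - i))"
  proof (rule sum.mono_neutral_right)
    show "\<forall>i\<in>{..a + b} - {a}. coeff p i * coeff q (a + b - i) = 0"
    proof
    fix i assume "i \<in> {..a + b} - {a}"
    then have i: "i \<noteq> a" by simp
    consider "i < a" | "i > a" using i by linarith
    then show "coeff p i * coeff q (a + b - i) = 0"
    proof cases
      case 1
      then have "coeff q (a + b - i) = 0" using assms by (intro coeff_eq_0) linarith
      then show ?thesis by simp
    next
      case 2
      then have "coeff p i = 0" using assms by (intro coeff_eq_0) linarith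
      then show ?thesis by simp
    qed
    qed
  qed auto
  finally show ?thesis by simp
qed

definition replace_vars :: "'n set \<Rightarrow> ('n \<Rightarrow> ('n, 'k::comm_ring_1) mpoly) \<Rightarrow> ('n, 'k) mpoly \<Rightarrow> ('n, 'k) mpoly"
  where "replace_vars N w = subst (\<lambda>i. if i \<in> N then w i else Var i)"

lemma ring_hom_replace_vars: "ring_hom (replace_vars N w)"
  by (simp add: replace_vars_def ring_hom_eval_mpoly ring_hom_Const)

lemmas replace_vars_simps [simp] = ring_hom_simps[OF ring_hom_replace_vars]

lemma replace_vars_Const [simp]: "replace_vars N w (Const c) = Const c"
  and replace_vars_Var [simp]: "replace_vars N w (Var i) = (if i \<in> N then w i else Var i)"
  by (simp_all add: replace_vars_def)

lemma replace_vars_free_of: "free_of N p \<Longrightarrow> replace_vars N w p = p"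
  unfolding replace_vars_def by (rule free_of_subst_id) auto

text \<open>
  In a form of degree \<open>n\<close> every factor \<open>X\<^sub>i + \<lambda> w\<^sub>i\<close> contributes at most one \<open>\<lambda>\<close>, and \<open>\<lambda>\<^sup>n\<close> arises only by
  choosing \<open>\<lambda> w\<^sub>i\<close> every time.
\<close>

lemma flow_component:
  assumes supp: "\<And>i. i \<notin> N \<Longrightarrow> w i = 0"
  shows "degree (flow w (coeff (scale_vars N p) n)) \<le> n \<and>
    coeff (flow w (coeff (scale_vars N p) n)) n = replace_vars N w (coeff (scale_vars N p) n)"
proof (induction p arbitrary: n rule: mpoly_induct)
  case (Const c)
  show ?case by (cases n) simp_all
next
  case (Var i)
  show ?case
    by (cases "i \<in> N"; cases n) (auto simp: coeff_monom coeff_pCons supp split: nat.splits)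
next
  case (add p q)
  then show ?case by (simp add: degree_add_le)
next
  case (mult p q)
  let ?f = "\<lambda>i. flow w (coeff (scale_vars N p) i)"
    and ?g = "\<lambda>i. flow w (coeff (scale_vars N q) (n - i))"
  have deg: "degree (?f i * ?g i) \<le> n" if "i \<le> n" for i
    using degree_mult_le[of "?f i" "?g i"] mult.IH(1)[of i] mult.IH(2)[of "n - i"] that by linarith
  have top: "coeff (?f i * ?g i) n = replace_vars N w (coeff (scale_vars N p) i) * replace_vars N w (coeff (scale_vars N q) (n - i))"
    if "i \<le> n" for i
    using coeff_mult_degree_le[of "?f i" i "?g i" "n - i"] mult.IH(1)[of i] mult.IH(2)[of "n - i"] that
    by (simp del: coeff_mult)
  have flow: "flow w (coeff (scale_vars N (p * q)) n) = (\<Sum>i\<le>n. ?f i * ?g i)"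
    by (simp add: coeff_mult)
  have "degree (\<Sum>i\<le>n. ?f i * ?g i) \<le> n"
    by (rule degree_sum_le) (use deg in auto)
  moreover have "coeff (\<Sum>i\<le>n. ?f i * ?g i) n
      = (\<Sum>i\<le>n. replace_vars N w (coeff (scale_vars N p) i) * replace_vars N w (coeff (scale_vars N q) (n - i)))"
    unfolding coeff_sum by (rule sum.cong) (use top in auto)
  ultimately show ?case unfolding flow by (simp add: coeff_mult)
qed

text \<open>
  The coefficient of \<open>\<lambda>\<^sup>n\<close> in \<open>p (X + \<lambda> w) = p\<close>, where \<open>n > 0\<close> is the degree of \<open>p\<close> in \<open>N\<close>, is the top
  form of \<open>p\<close> at \<open>w\<close>.
\<close>

lemma replace_vars_top_eq_0:
  fixes w :: "'n::linorder \<Rightarrow> ('n, 'k::{idom,ring_char_0}) mpoly"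
  assumes "quasi_transl w" "deriv_along w p = 0" and supp: "\<And>i. i \<notin> N \<Longrightarrow> w i = 0"
    and deg: "degree (scale_vars N p) > 0"
  shows "replace_vars N w (lead_coeff (scale_vars N p)) = 0"
proof -
  let ?n = "degree (scale_vars N p)" and ?c = "\<lambda>k. coeff (scale_vars N p) k"
  have "0 = coeff (flow w p) ?n"
    using quasi_transl_flow_kernel[OF assms(1,2)] deg by (simp add: coeff_pCons split: nat.splits)
  also have "flow w p = (\<Sum>k\<le>?n. flow w (?c k))"
    by (subst sum_coeff_scale_vars[of N p ?n]) simp_all
  also have "coeff \<dots> ?n = (\<Sum>k\<le>?n. coeff (flow w (?c k)) ?n)"
    by (simp add: coeff_sum)
  also have "\<dots> = (\<Sum>k\<in>{?n}. coeff (flow w (?c k)) ?n)"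
  proof (rule sum.mono_neutral_right)
    show "\<forall>k\<in>{..?n} - {?n}. coeff (flow w (?c k)) ?n = 0"
    proof
      fix k assume "k \<in> {..?n} - {?n}"
      with flow_component[where N = N and w = w, OF supp, where p = p and n = k]
      have "degree (flow w (?c k)) < ?n" by auto
      then show "coeff (flow w (?c k)) ?n = 0" by (rule coeff_eq_0)
    qed
  qed auto
  also have "\<dots> = replace_vars N w (?c ?n)"
    using flow_component[where N = N and w = w, OF supp, where p = p and n = ?n] by simp
  finally show ?thesis by simp
qed

section \<open>Homogeneous relations in two variables\<close>

lemma free_of_UNIV_Const:
  assumes "free_of UNIV p"
  obtains c where "p = Const c"
proof -
  have "\<exists>c. set_zero UNIV p = Const c"
  proof (induction p rule: mpoly_induct)
    case (Var i)
    show ?case by (rule exI[of _ 0]) (simp add: Const_def)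
  next
    case (add p q)
    then show ?case by (metis set_zero_simps(2) ring_hom_simps(2)[OF ring_hom_Const])
  next
    case (mult p q)
    then show ?case by (metis set_zero_simps(3) ring_hom_simps(3)[OF ring_hom_Const])
  qed auto
  with assms that show ?thesis by (auto simp: free_of_def)
qed

lemma free_of_UNIV_unit:
  fixes p :: "('n, 'k::field) mpoly"
  assumes "free_of UNIV p" "p \<noteq> 0"
  shows "p dvd 1"
proof -
  obtain c where c: "p = Const c" using free_of_UNIV_Const[OF assms(1)] .
  with assms(2) have "c \<noteq> 0" by (auto simp: Const_def)
  then have "1 = p * Const (inverse c)"
    unfolding c ring_hom_simps(3)[OF ring_hom_Const, symmetric]
      by (simp add: ring_hom_simps(1)[OF ring_hom_Const])
  then show ?thesis by (rule dvdI)
qed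

lemma unit_free_of:
  fixes p :: "('n::linorder, 'k::idom) mpoly"
  assumes "p dvd 1"
  shows "free_of N p"
proof -
  obtain q where "1 = p * q" using assms by (rule dvdE)
  then show ?thesis using free_of_factor[of N p q] by simp
qed

text \<open>
  The ratio of \<open>f\<close> and \<open>g\<close> is a ratio \<open>a : b\<close> of polynomials that do not involve \<open>N\<close>. Excluding
  \<open>0 : 0\<close> makes the linear relation \<open>b f - a g = 0\<close> nontrivial even when \<open>f = g = 0\<close>.
\<close>

definition commensurable :: "'n set \<Rightarrow> ('n, 'k::comm_ring_1) mpoly \<Rightarrow> ('n, 'k) mpoly \<Rightarrow> bool"
  where "commensurable N f g \<longleftrightarrow> (\<exists>d a b. f = d * a \<and> g = d * b \<and> free_of N a \<and> free_of N b \<and> (a \<noteq> 0 \<or> b \<noteq> 0))"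

lemma commensurableI: "f = d * a \<Longrightarrow> g = d * b \<Longrightarrow> free_of N a \<Longrightarrow> free_of N b \<Longrightarrow> a \<noteq> 0 \<or> b \<noteq> 0 \<Longrightarrow> commensurable N f g"
  unfolding commensurable_def by blast

lemma commensurable_0: "commensurable N 0 g" "commensurable N f 0"
  by (rule commensurableI[of _ g 0 _ 1] commensurableI[of _ f 1 _ 0]; simp)+

lemma commensurable_mult: "commensurable N f g \<Longrightarrow> commensurable N (d * f) (d * g)"
  unfolding commensurable_def 
proof (elim exE conjE)
  fix d' a b assume "f = d' * a" "g = d' * b" "free_of N a" "free_of N b" "a \<noteq> 0 \<or> b \<noteq> 0"
  then show "\<exists>d' a b. d * f = d' * a \<and> d * g = d' * b \<and> free_of N a \<and> free_of N b \<and> (a \<noteq> 0 \<or> b \<noteq> 0)"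
    by (intro exI[of _ "d * d'"] exI[of _ a] exI[of _ b]) (simp add: mult.assoc)
qed

lemma ring_hom_pcompose: "ring_hom (\<lambda>p. pcompose p q)"
  by (rule ring_homI) (simp_all add: pcompose_1 pcompose_add pcompose_mult)

text \<open>
  One half of the rational root theorem, after removing the factor \<open>X\<^sup>k\<close> that makes the constant
  coefficient vanish.
\<close>

lemma root_dvd_low_coeff:
  fixes p :: "'a::idom poly"
  assumes "poly p x = 0" "x \<noteq> 0" "p \<noteq> 0"
  obtains k where "coeff p k \<noteq> 0" "x dvd coeff p k"
proof -
  define k where "k = (LEAST k. coeff p k \<noteq> 0)"
  have k: "coeff p k \<noteq> 0"
    unfolding k_def by (rule LeastI[of _ "degree p"]) (use assms in auto)
  have "\<forall>l<k. coeff p l = 0" unfolding k_def using not_less_Least by blast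
  then obtain u where u: "p = monom 1 k * u"
    unfolding monom_1_dvd_iff'[symmetric] by (elim dvdE)
  have "coeff p k = coeff u 0" unfolding u by (simp add: coeff_monom_mult)
  moreover have "poly u x = 0" using assms u by (simp add: poly_monom)
  then have "x dvd coeff u 0"
  proof (cases u)
    case (pCons a u')
    with \<open>poly u x = 0\<close> have "a + x * poly u' x = 0" by simp
    then have "a = x * (- poly u' x)" unfolding mult_minus_right
      by (rule eq_neg_iff_add_eq_0[THEN iffD2])
    then show ?thesis by (simp add: pCons)
  qed
  ultimately have "x dvd coeff p k" by simp
  with k that show ?thesis by blast
qed

text \<open>
  The polynomial \<open>s (T, g)\<close> has the root \<open>f\<close>. By homogeneity its coefficients \<open>c\<^sub>k\<close> satisfy
  \<open>g\<^sup>k c\<^sub>k = g\<^sup>n e\<^sub>k\<close>, where \<open>e\<^sub>k\<close> are the coefficients of \<open>s (T, 1)\<close>, which involve none of the variables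
  in \<open>N\<close>. The rational root theorem makes \<open>f\<close> a divisor of some \<open>c\<^sub>k \<noteq> 0\<close>, hence of \<open>g\<^sup>n e\<^sub>k\<close> and of
  \<open>e\<^sub>k\<close>, and divisors of \<open>e\<^sub>k\<close> do not involve \<open>N\<close> either.
\<close>

lemma two_variable_relation_factor:
  fixes s :: "('n::linorder, 'k::idom) mpoly"
  assumes ij: "i \<in> N" "j \<in> N" "i \<noteq> j"
    and s: "s \<noteq> 0" "homogeneous N n s" "free_of (N - {i, j}) s"
    and v: "v i = f" "v j = g" "\<And>l. l \<notin> N \<Longrightarrow> v l = Var l"
    and rel: "subst v s = 0"
    and cop: "\<And>c. f dvd g * c \<Longrightarrow> f dvd c"
    and nz: "f \<noteq> 0" "g \<noteq> 0"
  shows "free_of N f"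
proof -
  define w where "w = (\<lambda>x y l. if l = i then y else if l = j then [:x:] else if l \<in> N then 0 else [:Var l:] :: ('n, 'k) mpoly poly)"
  define \<theta> where "\<theta> = (\<lambda>x. psubst (w x [:0, 1:]))"
  have scale: "x ^ k * coeff (\<theta> x s) k = x ^ n * coeff (\<theta> 1 s) k" for x k
  proof -
    have "pcompose (\<theta> x s) [:0, x:] = psubst (w x [:0, x:]) s"
      unfolding \<theta>_def
      by (rule ring_hom_eqI[where F = "\<lambda>s. pcompose (psubst (w x [:0, 1:]) s) [:0, x:]"])
        (auto intro: ring_hom_comp[OF ring_hom_pcompose] ring_hom_eval_mpoly ring_hom_pConst
          simp: w_def pcompose_pCons)
    also have "\<dots> = [:x:] ^ n * \<theta> 1 s"
      unfolding \<theta>_def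
        by (rule eval_mpoly_homogeneous[OF s(2) ring_hom_pConst]) (use ij in \<open>auto simp: w_def\<close>)
    finally have "coeff (pcompose (\<theta> x s) [:0, x:]) k = coeff ([:x:] ^ n * \<theta> 1 s) k" by simp
    then show ?thesis by (simp add: coeff_pcompose_linear poly_const_pow)
  qed
  have eval: "poly (\<theta> (u j) s) (u i) = subst u s" if "\<And>l. l \<notin> N \<Longrightarrow> u l = Var l" for u
    unfolding \<theta>_def poly_psubst
    by (rule free_of_eval_mpoly_cong[OF s(3) ring_hom_Const]) (use that ij in \<open>auto simp: w_def\<close>)
  \<comment> \<open>That \<open>s (T, 1)\<close> is nonzero is seen from \<open>s (T, X\<^sub>j)\<close>, whose value at \<open>T = X\<^sub>i\<close> is \<open>s\<close> itself.\<close>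
  have "\<theta> (Var j) s \<noteq> 0"
    using eval[of Var] s(1) by (auto simp: subst_Var)
  then obtain k0 where "coeff (\<theta> (Var j) s) k0 \<noteq> 0" by (auto simp: poly_eq_iff)
  moreover have "Var j \<noteq> (0 :: ('n, 'k) mpoly)"
    unfolding Var_def by (metis lookup_single_eq lookup_zero one_neq_zero)
  ultimately have "coeff (\<theta> 1 s) k0 \<noteq> 0"
    using scale[of "Var j" k0] by auto
  then have "\<theta> g s \<noteq> 0"
    using scale[of g k0] nz by auto
  moreover have "poly (\<theta> g s) f = 0"
    using eval[of v] v rel by simp
  ultimately obtain k where k: "coeff (\<theta> g s) k \<noteq> 0" "f dvd coeff (\<theta> g s) k"
    using root_dvd_low_coeff nz(1) by metis
  from k(2) have "f dvd g ^ n * coeff (\<theta> 1 s) k"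
    unfolding scale[of g k, symmetric] by (rule dvd_mult)
  then have "f dvd coeff (\<theta> 1 s) k"
    by (induction n) (auto simp: mult.assoc dest: cop)
  then obtain c where c: "coeff (\<theta> 1 s) k = f * c" by (rule dvdE)
  have "free_of N (coeff (\<theta> 1 q) m)" for q m
  proof (induction q arbitrary: m rule: mpoly_induct)
    case (Const c)
    show ?case by (cases m) (simp_all add: \<theta>_def)
  next
    case (Var l)
    show ?case by (cases "l \<in> N") (auto simp: \<theta>_def w_def coeff_pCons split: nat.splits)
  next
    case (add p q)
    then show ?case by (simp add: \<theta>_def)
  next
    case (mult p q)
    then show ?case by (auto simp: \<theta>_def coeff_mult intro!: free_of_sum)
  qed
  then have "free_of N (f * c)" by (metis c)
  moreover have "f * c \<noteq> 0"
    using scale[of g k] k(1) nz c by auto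
  ultimately show ?thesis by (rule free_of_factor)
qed

text \<open>
  Divide both values by their greatest common divisor. The relation, being homogeneous, persists for
  the coprime quotients, and by symmetry neither of them involves \<open>N\<close>.
\<close>

lemma two_variable_relation:
  fixes s :: "(4, 'k::field) mpoly"
  assumes ij: "i \<in> N" "j \<in> N" "i \<noteq> j"
    and s: "s \<noteq> 0" "homogeneous N n s" "free_of (N - {i, j}) s"
    and v: "\<And>l. l \<notin> N \<Longrightarrow> v l = Var l"
    and rel: "subst v s = 0"
  shows "commensurable N (v i) (v j)"
proof (cases "v i = 0 \<or> v j = 0")
  case True
  then show ?thesis by (elim disjE) (simp_all add: commensurable_0)
next
  case False
  then obtain d a b where dab: "v i = d * a" "v j = d * b" "coprime_split a b"
    using mpoly_gcd_factorization[of "v i" "v j"] by blast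
  with False have nz: "d \<noteq> 0" "a \<noteq> 0" "b \<noteq> 0" by auto
  define v' where "v' = (\<lambda>l. if l = i then a else if l = j then b else if l \<in> N then 0 else Var l)"
  have "subst v s = subst (\<lambda>l. if l \<in> N - {i, j} then 0 else v l) s"
    by (rule free_of_eval_mpoly_cong[OF s(3) ring_hom_Const]) auto
  also have "\<dots> = d ^ n * subst v' s"
    by (rule eval_mpoly_homogeneous[OF s(2) ring_hom_Const]) (use dab v ij in \<open>auto simp: v'_def\<close>)
  finally have rel': "subst v' s = 0" using rel nz by simp
  from dab(3) have cop: "a dvd b * c \<Longrightarrow> a dvd c" "b dvd a * c \<Longrightarrow> b dvd c" for c
    unfolding coprime_split_def by blast+
  have v': "v' i = a" "v' j = b" "\<And>l. l \<notin> N \<Longrightarrow> v' l = Var l"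
    using ij by (auto simp: v'_def)
  have "free_of N a"
    by (rule two_variable_relation_factor[OF ij s v' rel' cop(1) nz(2,3)])
  moreover have "free_of N b"
  proof (rule two_variable_relation_factor[OF ij(2,1) not_sym[OF ij(3)] s(1,2) _ v'(2,1,3) rel' cop(2) nz(3,2)])
    show "free_of (N - {j, i}) s" using s(3) by (simp add: insert_commute)
  qed
  ultimately show ?thesis using commensurableI[OF dab(1,2)] nz by blast
qed

text \<open>
  The order at \<open>0\<close> and the degree are both additive, and they agree for the product.
\<close>

lemma monom_factor:
  fixes p q :: "'a::idom poly"
  assumes "p * q = monom c n" "c \<noteq> 0"
  shows "p = monom (lead_coeff p) (degree p)"
proof -
  have nz: "p \<noteq> 0" "q \<noteq> 0" using assms by auto
  have "degree p + degree q = n"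
    using assms nz by (metis degree_monom_eq degree_mult_eq)
  moreover have "monom 1 n dvd p * q"
    using assms(1) by (intro dvdI[of _ _ "[:c:]"]) (simp add: mult.commute smult_monom)
  then have "n \<le> order 0 p + order 0 q"
    using nz by (simp add: monom_1_dvd_iff order_mult)
  moreover have "order 0 p \<le> degree p" "order 0 q \<le> degree q"
    using nz by (simp_all add: order_degree)
  ultimately have "degree p \<le> order 0 p" by linarith
  then have "\<forall>k<degree p. coeff p k = 0"
    using nz by (simp add: monom_1_dvd_iff[symmetric] monom_1_dvd_iff')
  then show ?thesis
    by (intro poly_eqI) (metis coeff_monom le_degree linorder_not_less order_antisym_conv)
qed

lemma homogeneous_factor:
  fixes p q :: "('n::linorder, 'k::idom) mpoly"
  assumes "homogeneous N n (p * q)" "p * q \<noteq> 0"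
  shows "homogeneous N (degree (scale_vars N p)) p"
proof -
  have "scale_vars N p = monom (lead_coeff (scale_vars N p)) (degree (scale_vars N p))"
    using assms by (intro monom_factor[of _ "scale_vars N q"]) (auto simp: homogeneous_def)
  with poly_scale_vars_1[of N p] show ?thesis
    unfolding homogeneous_def by (metis mult.right_neutral poly_monom power_one)
qed

lemma homogeneous_degree: "homogeneous N n p \<Longrightarrow> p \<noteq> 0 \<Longrightarrow> degree (scale_vars N p) = n"
  by (simp add: homogeneous_def degree_monom_eq)

text \<open>
  A common divisor of maximal total degree leaves quotients whose common divisors are constants.
\<close>

lemma greatest_common_factor:
  fixes w :: "'a \<Rightarrow> ('n::linorder, 'k::idom) mpoly"
  assumes "w l0 \<noteq> 0"
  obtains e w' where "e \<noteq> 0" "\<And>l. w l = e * w' l" "\<And>c. (\<And>l. c dvd w' l) \<Longrightarrow> free_of UNIV c"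
proof -
  let ?deg = "\<lambda>p :: ('n, 'k) mpoly. degree (scale_vars UNIV p)"
  have deg_mult: "?deg (p * q) = ?deg p + ?deg q" if "p * q \<noteq> 0" for p q
    using that by (simp add: degree_mult_eq)
  have "\<exists>e. (\<forall>l. e dvd w l) \<and> (\<forall>e'. (\<forall>l. e' dvd w l) \<longrightarrow> ?deg e' \<le> ?deg e)"
  proof (rule ex_has_greatest_nat[of _ 1 _ "Suc (?deg (w l0))"])
    show "\<forall>l. 1 dvd w l" by simp
    show "\<forall>y. (\<forall>l. y dvd w l) \<longrightarrow> ?deg y < Suc (?deg (w l0))"
    proof (intro allI impI)
      fix y assume "\<forall>l. y dvd w l"
      then obtain q where "w l0 = y * q" by (meson dvdE)
      with deg_mult[of y q] assms show "?deg y < Suc (?deg (w l0))" by simp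
    qed
  qed
  then obtain e where e: "\<And>l. e dvd w l" "\<And>e'. (\<forall>l. e' dvd w l) \<Longrightarrow> ?deg e' \<le> ?deg e" by blast
  from e(1) have "\<forall>l. \<exists>q. w l = e * q" by (meson dvdE)
  then obtain w' where w': "\<And>l. w l = e * w' l" by metis
  have nz: "e \<noteq> 0" "w' l0 \<noteq> 0" using assms w'[of l0] by auto
  have "free_of UNIV c" if c: "\<And>l. c dvd w' l" for c
  proof -
    have "\<forall>l. e * c dvd w l" using c by (simp add: w' mult_dvd_mono)
    then have "?deg (e * c) \<le> ?deg e" by (rule e(2))
    moreover have "c \<noteq> 0" using c[of l0] nz(2) by auto
    ultimately show ?thesis using deg_mult[of e c] nz(1) by (simp add: free_of_iff_degree)
  qed
  with nz w' that show ?thesis by blast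
qed

section \<open>Linear dependence of the components of a quasi-translation\<close>

text \<open>
  Polynomials read as univariate polynomials in the variable \<open>z\<close>, with coefficients that do not
  involve \<open>z\<close>.
\<close>

definition poly_in :: "'n \<Rightarrow> ('n, 'k::comm_ring_1) mpoly \<Rightarrow> ('n, 'k) mpoly poly"
  where "poly_in z = psubst (\<lambda>l. if l = z then [:0, 1:] else [:Var l:])"

lemma ring_hom_poly_in: "ring_hom (poly_in z)"
  by (simp add: poly_in_def ring_hom_eval_mpoly ring_hom_pConst)

lemmas poly_in_simps [simp] = ring_hom_simps[OF ring_hom_poly_in]

lemma poly_in_Const [simp]: "poly_in z (Const c) = [:Const c:]"
  and poly_in_Var [simp]: "poly_in z (Var i) = (if i = z then [:0, 1:] else [:Var i:])"
  by (simp_all add: poly_in_def)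

lemma poly_poly_in: "poly (poly_in z p) (Var z) = p"
  by (rule ring_hom_eqI[where F = "\<lambda>p. poly (poly_in z p) (Var z)"])
    (auto intro: ring_hom_comp[OF ring_hom_poly] ring_hom_poly_in ring_hom_id)

lemma poly_in_eq_0_iff [simp]: "poly_in z p = 0 \<longleftrightarrow> p = 0"
  using poly_poly_in[of z p] by auto

lemma poly_in_free_of: "free_of {z} p \<Longrightarrow> poly_in z p = [:p:]"
proof -
  assume "free_of {z} p"
  then have "poly_in z p = psubst (\<lambda>i. [:Var i:]) p"
    unfolding poly_in_def by (rule free_of_eval_mpoly_cong[OF _ ring_hom_pConst]) auto
  also have "\<dots> = [:p:]"
    by (rule ring_hom_eqI[where F = "psubst (\<lambda>i. [:Var i:])"])
      (auto intro: ring_hom_eval_mpoly ring_hom_pConst ring_hom_pCons)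
  finally show ?thesis .
qed

lemma free_of_coeff_poly_in: "free_of {z} (coeff (poly_in z p) n)"
proof (induction p arbitrary: n rule: mpoly_induct)
  case (mult p q)
  then show ?case by (auto simp: coeff_mult intro!: free_of_sum)
qed (auto simp: coeff_pCons split: nat.splits)

lemma free_of_iff_poly_in: "free_of {z} p \<longleftrightarrow> degree (poly_in z p) = 0"
proof
  assume "degree (poly_in z p) = 0"
  then obtain a where a: "poly_in z p = [:a:]" by (rule degree_eq_zeroE)
  then have "p = a" using poly_poly_in[of z p] by simp
  with a free_of_coeff_poly_in[of z p 0] show "free_of {z} p" by simp
qed (simp add: poly_in_free_of)

text \<open>
  The kernel of \<open>J\<close> is a prime ideal without nonzero elements free of \<open>z\<close>. Over the fraction field of
  the polynomials free of \<open>z\<close> it becomes a principal ideal, generated by an element \<open>p\<close> of least degree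
  in \<open>z\<close>; so \<open>p\<close> divides \<open>s q\<close> for every \<open>q\<close> in the ideal and a suitable nonzero \<open>s\<close> free of \<open>z\<close>. When \<open>p\<close> has
  least total degree among the possible choices, its common factors with \<open>s\<close> are constants, and \<open>p\<close>
  divides \<open>q\<close>.
\<close>

lemma prime_ideal_common_factor:
  fixes J :: "(4, 'k::field) mpoly \<Rightarrow> 'b::idom"
  assumes J: "ring_hom J" and free_of: "\<And>s. free_of {z} s \<Longrightarrow> J s = 0 \<Longrightarrow> s = 0"
    and ex: "J q0 = 0" "q0 \<noteq> 0"
  obtains p where "\<not> free_of {z} p" "\<And>q. J q = 0 \<Longrightarrow> p dvd q"
proof -
  note Js = ring_hom_simps[OF J]
  let ?zdeg = "\<lambda>p :: (4, 'k) mpoly. degree (poly_in z p)"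
    and ?tdeg = "\<lambda>p :: (4, 'k) mpoly. degree (scale_vars UNIV p)"
  define m where "m = (LEAST m. \<exists>p. J p = 0 \<and> p \<noteq> 0 \<and> ?zdeg p = m)"
  have "\<exists>p. J p = 0 \<and> p \<noteq> 0 \<and> ?zdeg p = m"
    unfolding m_def by (rule LeastI[of _ "?zdeg q0"]) (use ex in blast)
  then obtain p0 where p0: "J p0 = 0 \<and> p0 \<noteq> 0 \<and> ?zdeg p0 = m" by blast
  obtain p where p: "J p = 0 \<and> p \<noteq> 0 \<and> ?zdeg p = m"
    and tmin: "\<And>q. J q = 0 \<and> q \<noteq> 0 \<and> ?zdeg q = m \<Longrightarrow> ?tdeg p \<le> ?tdeg q"
    using ex_has_least_nat[of "\<lambda>p. J p = 0 \<and> p \<noteq> 0 \<and> ?zdeg p = m" p0 ?tdeg] p0 by blast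
  have zmin: "m \<le> ?zdeg q" if "J q = 0" "q \<noteq> 0" for q
    unfolding m_def by (rule Least_le) (use that in blast)
  have nfree: "\<not> free_of {z} p" using free_of[of p] p by blast
  then have m: "m > 0" using p by (simp add: free_of_iff_poly_in)
  have pseudo: "\<exists>s. s \<noteq> 0 \<and> free_of {z} s \<and> p dvd s * q" if "J q = 0" for q
    using that
  proof (induction "?zdeg q" arbitrary: q rule: less_induct)
    case less
    show ?case
    proof (cases "q = 0")
      case True
      then show ?thesis by (intro exI[of _ 1]) auto
    next
      case False
      define n where "n = ?zdeg q"
      have mn: "m \<le> n" unfolding n_def using zmin less.prems False by blast
      define a where "a = lead_coeff (poly_in z p)"
      define b where "b = lead_coeff (poly_in z q)"
      have ab: "free_of {z} a" "free_of {z} b" "a \<noteq> 0"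
        unfolding a_def b_def using p by (auto simp: free_of_coeff_poly_in)
      \<comment> \<open>One step of pseudo-division by \<open>p\<close> removes the leading term of \<open>q\<close> with respect to \<open>z\<close>.\<close>
      define q' where "q' = a * q - b * Var z ^ (n - m) * p"
      have Jq': "J q' = 0" using less.prems p by (simp add: q'_def Js)
      have zq': "poly_in z q' = smult a (poly_in z q) - smult b (monom 1 (n - m) * poly_in z p)"
        using ab by (simp add: q'_def poly_in_free_of monom_altdef mult.assoc)
      show ?thesis
      proof (cases "q' = 0")
        case True
        then have "a * q = p * (b * Var z ^ (n - m))" by (simp add: q'_def mult_ac)
        then have "p dvd a * q" by (rule dvdI)
        with ab show ?thesis by blast
      next
        case False
        have "?zdeg q' < n"
        proof -
          have "degree (monom 1 (n - m) * poly_in z p) \<le> n"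
            using degree_mult_le[of "monom 1 (n - m)" "poly_in z p"] p mn
              degree_monom_le[of "1 :: (4, 'k) mpoly" "n - m"] by linarith
          then have "degree (poly_in z q') \<le> n"
            unfolding zq' n_def
              by (intro degree_diff_le) (auto intro: order_trans[OF degree_smult_le])
          moreover have "coeff (poly_in z q') n = a * b - b * a"
            using p mn by (simp add: zq' coeff_monom_mult a_def b_def n_def)
          then have "coeff (poly_in z q') n = 0" by (simp add: mult.commute)
          moreover have "n > 0" using m mn by simp
          ultimately show ?thesis
            by (metis False eq_zero_or_degree_less poly_in_eq_0_iff)
        qed
        then obtain s where s: "s \<noteq> 0" "free_of {z} s" "p dvd s * q'"
          using less.hyps[OF _ Jq'] unfolding n_def by blast
        have "s * a * q = s * q' + p * (s * b * Var z ^ (n - m))"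
          by (simp add: q'_def algebra_simps)
        then have "p dvd s * a * q" using s(3) by simp
        with s ab show ?thesis by (intro exI[of _ "s * a"]) auto
      qed
    qed
  qed
  have "p dvd q" if Jq: "J q = 0" for q
  proof -
    obtain s u where s: "s \<noteq> 0" "free_of {z} s" "s * q = p * u"
      using pseudo[OF Jq] unfolding dvd_def by blast
    obtain h p' s' where h: "p = h * p'" "s = h * s'" "coprime_split p' s'"
      using mpoly_gcd_factorization[of p s] p by blast
    have nz: "h \<noteq> 0" "p' \<noteq> 0" using h p by auto
    have "free_of {z} h" using free_of_factor[of "{z}" h s'] s h by simp
    then have "J h \<noteq> 0" using free_of nz by blast
    \<comment> \<open>The factor \<open>h\<close> of \<open>p\<close> divides \<open>s\<close>, so it does not lie in the ideal, and the cofactor does. By the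
      choice of \<open>p\<close> the cofactor is not smaller than \<open>p\<close>, and \<open>h\<close> is a constant.\<close>
    then have Jp': "J p' = 0" using p h by (simp add: Js)
    have "?zdeg p = ?zdeg h + ?zdeg p'" using nz by (simp add: h(1) degree_mult_eq)
    then have "?zdeg p' = m" using zmin[OF Jp' nz(2)] p by linarith
    then have "?tdeg p \<le> ?tdeg p'" using tmin Jp' nz by blast
    moreover have "?tdeg p = ?tdeg h + ?tdeg p'" using nz by (simp add: h(1) degree_mult_eq)
    ultimately have "h dvd 1" using nz
      by (intro free_of_UNIV_unit) (simp_all add: free_of_iff_degree)
    have "h * (s' * q) = h * (p' * u)" using s(3) h by (simp add: mult.assoc)
    then have "s' * q = p' * u" using nz by simp
    then have "p' dvd s' * q" by (rule dvdI)
    with h(3) have "p' dvd q" unfolding coprime_split_def by blast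
    with \<open>h dvd 1\<close> show "p dvd q"
      unfolding h(1) by (metis mult_1 mult_dvd_mono)
  qed
  with nfree that show ?thesis by blast
qed

lemma commensurable_if_free_of: "free_of N a \<Longrightarrow> free_of N b \<Longrightarrow> commensurable N a b"
  by (cases "a = 0") (auto simp: commensurable_0 intro: commensurableI[of _ 1])

text \<open>
  After division by a common factor the components \<open>w'\<close> are coprime and still homogeneous of a common
  degree \<open>d'\<close>. If \<open>d' > 0\<close>, they are relations for themselves: each vanishes when \<open>w'\<close> is substituted.
  Let \<open>J q\<close> be \<open>q\<close> at \<open>\<lambda> w'\<close>; the zeros of \<open>J\<close> are the polynomials all of whose homogeneous components vanish
  at \<open>w'\<close>. A nonzero one that is free of \<open>z\<close> is a relation between \<open>w'\<^sub>i\<close> and \<open>w'\<^sub>j\<close> alone, and without such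
  an element all zeros of \<open>J\<close>, in particular all \<open>w'\<^sub>l\<close>, would have a nonconstant common factor.
\<close>

lemma homogeneous_quasi_transl_commensurable:
  fixes w :: "4 \<Rightarrow> (4, 'k::field_char_0) mpoly"
  assumes ijz: "i \<noteq> j" "i \<noteq> z" "j \<noteq> z"
    and supp: "\<And>l. l \<notin> {i, j, z} \<Longrightarrow> w l = 0"
    and quasi_transl: "quasi_transl w" and hom: "\<And>l. homogeneous {i, j, z} d (w l)"
  shows "commensurable {i, j, z} (w i) (w j)"
proof (cases "\<forall>l. w l = 0")
  case True
  then show ?thesis by (simp add: commensurable_0)
next
  case False
  then obtain l0 where l0: "w l0 \<noteq> 0" by blast
  let ?N = "{i, j, z}"
  obtain e w' where e: "e \<noteq> 0" and w: "\<And>l. w l = e * w' l"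
    and prim: "\<And>c. (\<And>l. c dvd w' l) \<Longrightarrow> free_of UNIV c"
    using greatest_common_factor[of w, OF l0] by blast
  have supp': "w' l = 0" if "l \<notin> ?N" for l
    using supp[OF that] w[of l] e by simp
  have l0': "w' l0 \<noteq> 0" using l0 w by auto
  have deriv_along_w: "deriv_along w q = e * deriv_along w' q" for q
    using deriv_along_cmult[of e w' q] w by (metis ext)
  have qt': "quasi_transl w'"
    unfolding quasi_transl_def
  proof
    fix l
    show "deriv_along w' (w' l) = 0"
    proof (cases "w' l = 0")
      case False
      have "deriv_along w (w' l) = 0"
      proof (rule quasi_transl_kernel_factor[OF quasi_transl])
        have "w' l * e = w l" by (simp add: w mult.commute)
        then show "deriv_along w (w' l * e) = 0" using quasi_transl by (simp only: quasi_transl_def)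
        show "w' l * e \<noteq> 0" using False e by simp
      qed
      then show ?thesis using deriv_along_w e by simp
    qed simp
  qed
  define d' where "d' = degree (scale_vars ?N (w' l0))"
  have hom': "homogeneous ?N d' (w' l)" for l
  proof (cases "w' l = 0")
    case True
    then show ?thesis by (simp add: homogeneous_def)
  next
    case False
    have "degree (scale_vars ?N (w' l)) + degree (scale_vars ?N e) = d" if "w' l \<noteq> 0" for l
    proof -
      have "degree (scale_vars ?N (w l)) = d" using homogeneous_degree[OF hom] that e w by simp
      then show ?thesis using that e by (simp add: w degree_mult_eq)
    qed
    from this[OF False] this[OF l0'] have "degree (scale_vars ?N (w' l)) = d'" by (simp add: d'_def)
    moreover have "homogeneous ?N (degree (scale_vars ?N (w' l))) (w' l)"
      using homogeneous_factor[of ?N d "w' l" e] hom[of l] False e by (simp add: w mult.commute)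
    ultimately show ?thesis by simp
  qed
  have "commensurable ?N (w' i) (w' j)"
  proof (cases "d' = 0")
    case True
    then show ?thesis using hom'
      by (intro commensurable_if_free_of) (simp_all add: free_of_iff_homogeneous)
  next
    case d': False
    define J where "J = (\<lambda>q. map_poly (replace_vars ?N w') (scale_vars ?N q))"
    have J: "ring_hom J" unfolding J_def
      by (intro ring_hom_comp[OF ring_hom_map_poly] ring_hom_replace_vars ring_hom_scale_vars)
    have coeff_J: "coeff (J q) n = replace_vars ?N w' (coeff (scale_vars ?N q) n)" for q n
      by (simp add: J_def coeff_map_poly)
    have Jw': "J (w' l) = 0" for l
    proof (cases "w' l = 0")
      case True
      then show ?thesis by (simp add: J_def)
    next
      case False
      have scale_vars: "scale_vars ?N (w' l) = monom (w' l) d'" using hom'[of l]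
        by (simp add: homogeneous_def)
      have "replace_vars ?N w' (lead_coeff (scale_vars ?N (w' l))) = 0"
        using qt' False d'
          by (intro replace_vars_top_eq_0[OF qt' _ supp'])
            (auto simp: quasi_transl_def scale_vars degree_monom_eq)
      then show ?thesis using False by (simp add: J_def scale_vars degree_monom_eq map_poly_monom)
    qed
    show ?thesis
    proof (cases "\<exists>s. free_of {z} s \<and> J s = 0 \<and> s \<noteq> 0")
      case True
      then obtain s where s: "free_of {z} s" "J s = 0" "s \<noteq> 0" by blast
      define t where "t = lead_coeff (scale_vars ?N s)"
      have "commensurable ?N ((\<lambda>l. if l \<in> ?N then w' l else Var l) i) ((\<lambda>l. if l \<in> ?N then w' l else Var l) j)"
      proof (rule two_variable_relation)
        show "t \<noteq> 0" using s by (simp add: t_def)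
        show "homogeneous ?N (degree (scale_vars ?N s)) t" unfolding t_def
          by (rule homogeneous_coeff_scale_vars)
        have "?N - {i, j} = {z}" using ijz by auto
        then show "free_of (?N - {i, j}) t"
          unfolding t_def using free_of_coeff_scale_vars[OF s(1)] by simp
        show "subst (\<lambda>l. if l \<in> ?N then w' l else Var l) t = 0"
          using coeff_J[of s "degree (scale_vars ?N s)"] s(2) by (simp add: replace_vars_def t_def)
      qed (use ijz in auto)
      then show ?thesis by simp
    next
      case False
      then have nofree: "\<And>s. free_of {z} s \<Longrightarrow> J s = 0 \<Longrightarrow> s = 0" by blast
      obtain p where p: "\<not> free_of {z} p" "\<And>q. J q = 0 \<Longrightarrow> p dvd q"
        using prime_ideal_common_factor[OF J nofree Jw' l0'] by blast
      have "free_of UNIV p" by (rule prim) (use p(2) Jw' in blast)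
      then have "free_of {z} p" by (rule free_of_mono) simp
      with p(1) show ?thesis by blast
    qed
  qed
  then show ?thesis unfolding w by (rule commensurable_mult)
qed

lemma commensurable_relation:
  assumes "commensurable N f g"
  obtains a b where "free_of N a" "free_of N b" "a \<noteq> 0 \<or> b \<noteq> 0" "a * f + b * g = 0"
proof -
  obtain d a b where "f = d * a" "g = d * b" "free_of N a" "free_of N b" "a \<noteq> 0 \<or> b \<noteq> 0"
    using assms unfolding commensurable_def by blast
  then show ?thesis by (intro that[of b "- a"]) auto
qed

text \<open>
  With \<open>d\<close> the largest degree of the \<open>w\<^sub>l\<close>, the derivation with values \<open>w\<^sub>l\<close> maps forms of degree \<open>n\<close> to
  degree at most \<open>n + d - 1\<close>, and the component of that degree comes from the top components of the
  \<open>w\<^sub>l\<close>. The factor \<open>\<lambda>\<close> raises all degrees by one, which covers \<open>n + d = 0\<close> without truncated subtraction.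
\<close>

lemma deriv_along_top_component:
  assumes supp: "\<And>l. l \<notin> N \<Longrightarrow> w l = 0" and deg: "\<And>l. degree (scale_vars N (w l)) \<le> d"
  defines "w' \<equiv> \<lambda>l. coeff (scale_vars N (w l)) d"
  shows "degree ([:0, 1:] * scale_vars N (deriv_along w (coeff (scale_vars N q) n))) \<le> n + d \<and>
    coeff ([:0, 1:] * scale_vars N (deriv_along w (coeff (scale_vars N q) n))) (n + d) = deriv_along w' (coeff (scale_vars N q) n)"
proof (induction q arbitrary: n rule: mpoly_induct)
  case (Const c)
  show ?case by (cases n) simp_all
next
  case (Var i)
  have w'_0: "w' i = 0" if "i \<notin> N" using supp[OF that] by (simp add: w'_def)
  have "degree (pCons 0 (scale_vars N (w i))) \<le> Suc d"
    using deg[of i] by (simp add: degree_pCons_eq_if)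
  then show ?case
    by (cases "i \<in> N"; cases n)
      (auto simp: coeff_monom coeff_pCons supp w'_0 w'_def split: nat.splits)
next
  case (add p q)
  then show ?case by (simp add: degree_add_le distrib_left del: mult_pCons_left)
next
  case (mult p q)
  define L where "L = (\<lambda>a. [:0, 1:] * scale_vars N (deriv_along w a))"
  let ?p = "\<lambda>i. coeff (scale_vars N p) i" and ?q = "\<lambda>i. coeff (scale_vars N q) (n - i)"
  have comp: "degree (L (?p i * ?q i)) \<le> n + d \<and> coeff (L (?p i * ?q i)) (n + d) = deriv_along w' (?p i * ?q i)"
    if i: "i \<le> n" for i
  proof -
    have L: "L (?p i * ?q i) = L (?p i) * scale_vars N (?q i) + scale_vars N (?p i) * L (?q i)"
      by (simp add: L_def algebra_simps)
    have scale_vars: "scale_vars N (?p i) = monom (?p i) i" "scale_vars N (?q i) = monom (?q i) (n - i)"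
      using homogeneous_coeff_scale_vars unfolding homogeneous_def by blast+
    have deg: "degree (scale_vars N (?p i)) \<le> i" "degree (scale_vars N (?q i)) \<le> n - i"
      unfolding scale_vars by (rule degree_monom_le)+
    have degL: "degree (L (?p i)) \<le> i + d" "degree (L (?q i)) \<le> n - i + d"
      and topL: "coeff (L (?p i)) (i + d) = deriv_along w' (?p i)"
        "coeff (L (?q i)) (n - i + d) = deriv_along w' (?q i)"
      using mult.IH(1)[of i] mult.IH(2)[of "n - i"] unfolding L_def by auto
    have n: "(i + d) + (n - i) = n + d" "i + (n - i + d) = n + d" using i by auto
    have "coeff (L (?p i) * scale_vars N (?q i)) (n + d) = deriv_along w' (?p i) * ?q i"
      using coeff_mult_degree_le[OF degL(1) deg(2)] unfolding n topL scale_vars(2) by simp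
    moreover have "coeff (scale_vars N (?p i) * L (?q i)) (n + d) = ?p i * deriv_along w' (?q i)"
      using coeff_mult_degree_le[OF deg(1) degL(2)] unfolding n topL scale_vars(1) by simp
    moreover have "degree (L (?p i) * scale_vars N (?q i)) \<le> n + d"
      using degree_mult_le[of "L (?p i)" "scale_vars N (?q i)"] deg degL n by linarith
    moreover have "degree (scale_vars N (?p i) * L (?q i)) \<le> n + d"
      using degree_mult_le[of "scale_vars N (?p i)" "L (?q i)"] deg degL n by linarith
    ultimately show ?thesis unfolding L by (simp add: degree_add_le)
  qed
  have eq: "coeff (scale_vars N (p * q)) n = (\<Sum>i\<le>n. ?p i * ?q i)" by (simp add: coeff_mult)
  have L_sum: "L (\<Sum>i\<le>n. ?p i * ?q i) = (\<Sum>i\<le>n. L (?p i * ?q i))"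
    unfolding L_def twisted_deriv_simps(6)[OF twisted_deriv_deriv_along] scale_vars_simps(8) sum_distrib_left ..
  have "degree (\<Sum>i\<le>n. L (?p i * ?q i)) \<le> n + d"
    by (rule degree_sum_le) (use comp in auto)
  moreover have "coeff (\<Sum>i\<le>n. L (?p i * ?q i)) (n + d) = deriv_along w' (\<Sum>i\<le>n. ?p i * ?q i)"
    unfolding coeff_sum twisted_deriv_simps(6)[OF twisted_deriv_deriv_along]
      by (rule sum.cong) (use comp in auto)
  ultimately show ?case
    unfolding eq L_sum[symmetric] unfolding L_def by blast
qed

text \<open>
  The top component of the identity \<open>D w\<^sub>l = 0\<close>.
\<close>

lemma quasi_transl_top_component:
  assumes quasi_transl: "quasi_transl w" and supp: "\<And>l. l \<notin> N \<Longrightarrow> w l = 0"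
    and deg: "\<And>l. degree (scale_vars N (w l)) \<le> d"
  shows "quasi_transl (\<lambda>l. coeff (scale_vars N (w l)) d)"
  unfolding quasi_transl_def
proof
  fix l
  let ?top = "\<lambda>l. coeff (scale_vars N (w l)) d" and ?c = "\<lambda>n. coeff (scale_vars N (w l)) n"
  let ?L = "\<lambda>a. [:0, 1:] * scale_vars N (deriv_along w a)"
  have w: "w l = (\<Sum>n\<le>d. ?c n)" by (rule sum_coeff_scale_vars[OF deg])
  have "0 = coeff (?L (w l)) (d + d)" using quasi_transl by (simp add: quasi_transl_def)
  also have "?L (w l) = (\<Sum>n\<le>d. ?L (?c n))"
    unfolding twisted_deriv_simps(6)[OF twisted_deriv_deriv_along, symmetric] scale_vars_simps(8)[symmetric] sum_distrib_left[symmetric] w[symmetric] ..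
  also have "coeff \<dots> (d + d) = (\<Sum>n\<le>d. coeff (?L (?c n)) (d + d))"
    by (rule coeff_sum)
  also have "\<dots> = (\<Sum>n\<in>{d}. coeff (?L (?c n)) (d + d))"
  proof (rule sum.mono_neutral_right)
    show "\<forall>n\<in>{..d} - {d}. coeff (?L (?c n)) (d + d) = 0"
    proof
      fix n assume "n \<in> {..d} - {d}"
      then have "degree (?L (?c n)) < d + d"
        using deriv_along_top_component[of N w d "w l" n, OF supp deg] by auto
      then show "coeff (?L (?c n)) (d + d) = 0" by (rule coeff_eq_0)
    qed
  qed auto
  also have "\<dots> = deriv_along ?top (?top l)"
    using deriv_along_top_component[of N w d "w l" d, OF supp deg] by simp
  finally show "deriv_along ?top (?top l) = 0" by simp
qed

text \<open>
  Let \<open>t\<close> be the top components of \<open>w\<close>, which are proportional to a vector \<open>c\<close> free of \<open>X\<^sub>i, X\<^sub>j, X\<^sub>z\<close>. The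
  kernel element \<open>t\<^sub>z\<close> is then constant along \<open>c\<close>, so \<open>t\<^sub>z (c\<^sub>z X - X\<^sub>z c) = c\<^sub>z\<^sup>d t\<^sub>z (X)\<close>. On the left
  the argument has \<open>z\<close>-component \<open>0\<close>, so the left side is a form \<open>s\<close> in two variables at
  \<open>c\<^sub>z X\<^sub>i - X\<^sub>z c\<^sub>i\<close> and \<open>c\<^sub>z X\<^sub>j - X\<^sub>z c\<^sub>j\<close>. Since \<open>t\<^sub>z\<close> vanishes at \<open>w\<close>, the polynomials \<open>c\<^sub>z w\<^sub>i - c\<^sub>i w\<^sub>z\<close> and
  \<open>c\<^sub>z w\<^sub>j - c\<^sub>j w\<^sub>z\<close> satisfy the relation \<open>s\<close>.
\<close>

lemma quasi_transl_linear_relation_top: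
  fixes w :: "4 \<Rightarrow> (4, 'k::field_char_0) mpoly"
  assumes ijz: "i \<noteq> j" "i \<noteq> z" "j \<noteq> z"
    and supp: "\<And>l. l \<notin> {i, j, z} \<Longrightarrow> w l = 0" and quasi_transl: "quasi_transl w"
    and max: "\<And>l. degree (scale_vars {i, j, z} (w l)) \<le> degree (scale_vars {i, j, z} (w z))"
  shows "\<exists>a. (\<forall>l. free_of {i, j, z} (a l)) \<and> (\<exists>l\<in>{i, j, z}. a l \<noteq> 0) \<and> (\<Sum>l\<in>{i, j, z}. a l * w l) = 0"
proof -
  let ?N = "{i, j, z}"
  have relation: ?thesis
    if "free_of ?N a" "free_of ?N b" "free_of ?N c" "a \<noteq> 0 \<or> b \<noteq> 0 \<or> c \<noteq> 0" "a * w i + b * w j + c * w z = 0" for a b c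
    using that ijz
    by (intro exI[of _ "\<lambda>l. if l = i then a else if l = j then b else c"]) (auto simp: add.assoc)
  define d where "d = degree (scale_vars ?N (w z))"
  show ?thesis
  proof (cases "d = 0")
    case True
    then have "commensurable ?N (w i) (w j)"
      using max by (intro commensurable_if_free_of) (simp_all add: free_of_iff_degree d_def)
    then obtain a b where "free_of ?N a" "free_of ?N b" "a \<noteq> 0 \<or> b \<noteq> 0" "a * w i + b * w j = 0"
      by (rule commensurable_relation)
    then show ?thesis by (intro relation[of a b 0]) auto
  next
    case False
    define t where "t = (\<lambda>l. coeff (scale_vars ?N (w l)) d)"
    have quasi_transl_t: "quasi_transl t" unfolding t_def
      by (rule quasi_transl_top_component[OF quasi_transl supp]) (use max in \<open>auto simp: d_def\<close>)
    have supp_t: "t l = 0" if "l \<notin> ?N" for l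
      using supp[OF that] by (simp add: t_def)
    have hom_t: "homogeneous ?N d (t l)" for l
      unfolding t_def by (rule homogeneous_coeff_scale_vars)
    have tz: "t z \<noteq> 0" using False by (auto simp: t_def d_def)
    have replace_vars_tz: "replace_vars ?N w (t z) = 0"
      unfolding t_def d_def
      by (rule replace_vars_top_eq_0[OF quasi_transl _ supp])
        (use quasi_transl False in \<open>auto simp: quasi_transl_def d_def\<close>)
    have "commensurable ?N (t i) (t z)"
      using homogeneous_quasi_transl_commensurable[of i z j t d] ijz supp_t quasi_transl_t hom_t
        by (simp add: insert_commute)
    then obtain d1 a1 b1 where 1: "t i = d1 * a1" "t z = d1 * b1" "free_of ?N a1" "free_of ?N b1"
      unfolding commensurable_def by blast
    have "commensurable ?N (t j) (t z)"
      using homogeneous_quasi_transl_commensurable[of j z i t d] ijz supp_t quasi_transl_t hom_t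
        by (simp add: insert_commute)
    then obtain d2 a2 b2 where 2: "t j = d2 * a2" "t z = d2 * b2" "free_of ?N a2" "free_of ?N b2"
      unfolding commensurable_def by blast
    \<comment> \<open>From \<open>t\<^sub>i b\<^sub>1 = t\<^sub>z a\<^sub>1\<close> and \<open>t\<^sub>j b\<^sub>2 = t\<^sub>z a\<^sub>2\<close>, with the common denominator \<open>b\<^sub>1 b\<^sub>2\<close>.\<close>
    define c where "c = (\<lambda>l. if l = i then a1 * b2 else if l = j then a2 * b1 else if l = z then b1 * b2 else 0)"
    have b_nz: "b1 \<noteq> 0" "b2 \<noteq> 0" using 1 2 tz by auto
    have c_free_of: "free_of ?N (c l)" for l using 1 2 by (auto simp: c_def)
    have c_supp: "c l = 0" if "l \<notin> ?N" for l using that by (simp add: c_def)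
    have cz: "c z \<noteq> 0" using b_nz ijz by (simp add: c_def)
    have proportional: "b1 * b2 * t l = t z * c l" for l
    proof (cases "l = i")
      case True
      have "b1 * b2 * t i = (d1 * b1) * (a1 * b2)" by (simp add: 1(1) mult_ac)
      then show ?thesis using True by (simp add: c_def 1(2)[symmetric])
    next
      case li: False
      show ?thesis
      proof (cases "l = j")
        case True
        have "b1 * b2 * t j = (d2 * b2) * (a2 * b1)" by (simp add: 2(1) mult_ac)
        then show ?thesis using True li by (simp add: c_def 2(2)[symmetric])
      qed (use li supp_t in \<open>auto simp: c_def mult.commute\<close>)
    qed
    have "t z * deriv_along c (t z) = b1 * b2 * deriv_along t (t z)"
      unfolding deriv_along_cmult[symmetric] proportional ..
    then have "deriv_along c (t z) = 0" using quasi_transl_t tz by (simp add: quasi_transl_def)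
    moreover have "quasi_transl c"
      unfolding quasi_transl_def by (intro allI deriv_along_free_of[OF c_free_of]) (rule c_supp)
    ultimately have flow_tz: "flow c (t z) = [:t z:]" by (rule quasi_transl_flow_kernel[rotated])
    define v where "v = (\<lambda>l. if l \<in> ?N then c z * Var l - Var z * c l else Var l)"
    define u where "u = (\<lambda>l. if l \<in> ?N then c z * Var l else Var l)"
    \<comment> \<open>The flow along \<open>c\<close> at the point \<open>c\<^sub>z X\<close> and the time \<open>- X\<^sub>z\<close>.\<close>
    have "subst v (t z) = poly (map_poly (subst u) (flow c (t z))) (- Var z)"
    proof -
      have "subst u (c l) = c l" for l
        by (rule free_of_subst_id[OF c_free_of]) (auto simp: u_def)
      then have "poly (map_poly (subst u) (flow c (t z))) (- Var z)
          = subst (\<lambda>l. u l + - Var z * c l) (t z)"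
        unfolding flow_def map_subst_psubst poly_psubst by (simp add: map_poly_pCons)
      also have "(\<lambda>l. u l + - Var z * c l) = v"
        by (auto simp: u_def v_def c_supp)
      finally show ?thesis ..
    qed
    also have "\<dots> = subst u (t z)" unfolding flow_tz by (simp add: map_poly_pCons)
    also have "\<dots> = c z ^ d * t z"
      using eval_mpoly_homogeneous[OF hom_t ring_hom_Const, of u "c z" Var z]
        by (simp add: u_def subst_Var)
    finally have v_tz: "subst v (t z) = c z ^ d * t z" .
    define s where "s = set_zero {z} (t z)"
    have "subst v s = subst v (t z)"
      unfolding s_def set_zero_def subst_subst
      by (rule arg_cong[where f = "\<lambda>v. subst v (t z)"]) (auto simp: v_def)
    then have v_s: "subst v s = c z ^ d * t z" using v_tz by simp
    define y where "y = (\<lambda>l. replace_vars ?N w (v l))"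
    have "commensurable ?N (y i) (y j)"
    proof (rule two_variable_relation)
      show "s \<noteq> 0" using v_s cz tz by auto
      show "homogeneous ?N d s" unfolding s_def by (rule homogeneous_set_zero[OF hom_t])
      have "?N - {i, j} = {z}" using ijz by auto
      then show "free_of (?N - {i, j}) s" by (simp add: s_def free_of_set_zero)
      have "subst y s = replace_vars ?N w (subst v s)"
        unfolding y_def replace_vars_def subst_subst ..
      then show "subst y s = 0" by (simp add: v_s replace_vars_tz)
      show "y l = Var l" if "l \<notin> ?N" for l using that by (simp add: y_def v_def)
    qed (use ijz in auto)
    then obtain a b where ab: "free_of ?N a" "free_of ?N b" "a \<noteq> 0 \<or> b \<noteq> 0" "a * y i + b * y j = 0"
      by (rule commensurable_relation)
    have y: "y l = c z * w l - w z * c l" if "l \<in> ?N" for l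
    proof -
      have "v l = c z * Var l - Var z * c l" using that by (auto simp: v_def)
      then show ?thesis using that by (simp add: y_def replace_vars_free_of c_free_of)
    qed
    have "(a * c z) * w i + (b * c z) * w j + (- (a * c i + b * c j)) * w z = 0"
      using ab(4) by (simp add: y algebra_simps)
    then show ?thesis
      by (intro relation) (use ab cz c_free_of in auto)
  qed
qed

lemma quasi_transl_linear_relation:
  fixes w :: "4 \<Rightarrow> (4, 'k::field_char_0) mpoly"
  assumes ijz: "i \<noteq> j" "i \<noteq> z" "j \<noteq> z"
    and supp: "\<And>l. l \<notin> {i, j, z} \<Longrightarrow> w l = 0" and quasi_transl: "quasi_transl w"
  shows "\<exists>a. (\<forall>l. free_of {i, j, z} (a l)) \<and> (\<exists>l\<in>{i, j, z}. a l \<noteq> 0) \<and> (\<Sum>l\<in>{i, j, z}. a l * w l) = 0"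
proof -
  define deg where "deg = (\<lambda>l. degree (scale_vars {i, j, z} (w l)))"
  obtain m where m: "\<And>l. deg l \<le> deg m"
  proof -
    have "Max (deg ` UNIV) \<in> deg ` UNIV" by (rule Max_in) auto
    then obtain m where m: "Max (deg ` UNIV) = deg m" by blast
    have "deg l \<le> Max (deg ` UNIV)" for l by (rule Max_ge) auto
    with m show ?thesis by (intro that[of m]) simp
  qed
  consider "m = i" | "m = j" | "m = z" | "m \<notin> {i, j, z}" by blast
  then show ?thesis
  proof cases
    case 1
    have eq: "{j, z, i} = {i, j, z}" by auto
    show ?thesis
      by (rule quasi_transl_linear_relation_top[of j z i w, unfolded eq])
        (use ijz supp quasi_transl m 1 in \<open>auto simp: deg_def\<close>)
  next
    case 2
    have eq: "{i, z, j} = {i, j, z}" by auto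
    show ?thesis
      by (rule quasi_transl_linear_relation_top[of i z j w, unfolded eq])
        (use ijz supp quasi_transl m 2 in \<open>auto simp: deg_def\<close>)
  next
    case 3
    show ?thesis
      by (rule quasi_transl_linear_relation_top)
        (use ijz supp quasi_transl m 3 in \<open>auto simp: deg_def\<close>)
  next
    case 4
    show ?thesis
      by (rule quasi_transl_linear_relation_top)
        (use ijz supp quasi_transl m[unfolded deg_def supp[OF 4]] in auto)
  qed
qed

section \<open>The kernel when two variables are constants\<close>

definition partial_deriv :: "'n \<Rightarrow> ('n, 'k::comm_ring_1) mpoly \<Rightarrow> ('n, 'k) mpoly"
  where "partial_deriv z = deriv_along (\<lambda>l. if l = z then 1 else 0)"

lemma twisted_deriv_partial_deriv: "twisted_deriv (\<lambda>x. x) (partial_deriv z)"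
  by (simp add: partial_deriv_def twisted_deriv_deriv_along)

lemmas partial_deriv_simps [simp] = twisted_deriv_simps[OF twisted_deriv_partial_deriv]

lemma partial_deriv_Const [simp]: "partial_deriv z (Const c) = 0"
  and partial_deriv_Var [simp]: "partial_deriv z (Var i) = (if i = z then 1 else 0)"
  and partial_deriv_1 [simp]: "partial_deriv z 1 = 0"
  by (simp_all add: partial_deriv_def)

lemma partial_deriv_free_of: "free_of N p \<Longrightarrow> z \<in> N \<Longrightarrow> partial_deriv z p = 0"
  unfolding partial_deriv_def by (rule deriv_along_free_of) auto

lemma partial_deriv_commute: "partial_deriv y (partial_deriv z p) = partial_deriv z (partial_deriv y p)"
  by (induction p rule: mpoly_induct) (simp_all add: algebra_simps)

lemma poly_in_partial_deriv:
  fixes p :: "('n::linorder, 'k::idom) mpoly"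
  shows "poly_in z (partial_deriv z p) = pderiv (poly_in z p)"
  by (rule twisted_deriv_eqI[where F = "\<lambda>p. poly_in z (partial_deriv z p)"])
    (auto intro: twisted_deriv_comp2[OF twisted_deriv_partial_deriv ring_hom_poly_in] twisted_deriv_comp[OF twisted_deriv_pderiv ring_hom_poly_in]
      simp: pderiv_pCons)

lemma partial_deriv_eq_0_imp_free_of:
  fixes p :: "('n::linorder, 'k::{idom, ring_char_0}) mpoly"
  assumes "partial_deriv z p = 0"
  shows "free_of {z} p"
  using poly_in_partial_deriv[of z p] assms by (simp add: free_of_iff_poly_in pderiv_eq_0_iff)

lemma free_of_insert: "free_of {x} p \<Longrightarrow> free_of N p \<Longrightarrow> free_of (insert x N) p"
proof -
  have "set_zero {x} (set_zero N p) = set_zero (insert x N) p"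
    by (rule ring_hom_eqI[where F = "\<lambda>p. set_zero {x} (set_zero N p)"])
      (auto intro: ring_hom_comp[OF ring_hom_set_zero] ring_hom_set_zero)
  then show "free_of {x} p \<Longrightarrow> free_of N p \<Longrightarrow> free_of (insert x N) p" by (simp add: free_of_def)
qed

text \<open>
  The partial derivative with respect to a variable in \<open>N\<close> lowers degrees in \<open>N\<close> by one; the factor \<open>\<lambda>\<close>
  makes up for this.
\<close>

lemma degree_partial_deriv_less:
  fixes p :: "('n::linorder, 'k::idom) mpoly"
  assumes "z \<in> N" "partial_deriv z p \<noteq> 0"
  shows "degree (scale_vars N (partial_deriv z p)) < degree (scale_vars N p)"
proof -
  have "[:0, 1:] * scale_vars N (partial_deriv z p) = map_poly (partial_deriv z) (scale_vars N p)"
  proof (rule twisted_deriv_eqI[where F = "\<lambda>p. [:0, 1:] * scale_vars N (partial_deriv z p)"])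
    show "twisted_deriv (scale_vars N) (\<lambda>p. [:0, 1:] * scale_vars N (partial_deriv z p))"
      by (rule twisted_deriv_cmult[OF twisted_deriv_comp2[OF twisted_deriv_partial_deriv ring_hom_scale_vars]])
    show "twisted_deriv (scale_vars N) (\<lambda>p. map_poly (partial_deriv z) (scale_vars N p))"
      by (rule twisted_deriv_comp[OF twisted_deriv_map_poly[OF twisted_deriv_partial_deriv] ring_hom_scale_vars])
  qed (use assms(1) in \<open>auto simp: map_poly_pCons map_poly_monom monom_altdef\<close>)
  then have "degree ([:0, 1:] * scale_vars N (partial_deriv z p)) \<le> degree (scale_vars N p)"
    using map_poly_degree_leq by metis
  then show ?thesis using assms(2) by (simp add: degree_pCons_eq)
qed

text \<open>
  Integration term by term of the expansion in powers of \<open>z\<close>, whose coefficients do not involve \<open>z\<close>.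
\<close>

lemma antiderivative:
  fixes r :: "('n, 'k::field_char_0) mpoly"
  obtains p where "partial_deriv z p = r"
proof -
  define c where "c = (\<lambda>n. coeff (poly_in z r) n)"
  have pow: "partial_deriv z (Var z ^ Suc n :: ('n, 'k) mpoly) = of_nat (Suc n) * Var z ^ n" for n
    by (induction n) (simp_all add: algebra_simps)
  have inv: "Const (inverse (of_nat (Suc n))) * of_nat (Suc n) = (1 :: ('n, 'k) mpoly)" for n
  proof -
    have "(of_nat m :: ('n, 'k) mpoly) = Const (of_nat m)" for m
      by (induction m) (simp_all add: ring_hom_simps[OF ring_hom_Const])
    then show ?thesis
      by (simp only: ring_hom_simps(3)[OF ring_hom_Const, symmetric])
        (simp add: ring_hom_simps(1)[OF ring_hom_Const] del: of_nat_Suc)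
  qed
  have "partial_deriv z (Const (inverse (of_nat (Suc n))) * c n * Var z ^ Suc n) = c n * Var z ^ n" for n
  proof -
    have "partial_deriv z (c n) = 0" unfolding c_def
      by (rule partial_deriv_free_of[OF free_of_coeff_poly_in]) simp
    then have "partial_deriv z (Const (inverse (of_nat (Suc n))) * c n * Var z ^ Suc n)
        = (Const (inverse (of_nat (Suc n))) * of_nat (Suc n)) * (c n * Var z ^ n)"
      using pow[of n] by (simp only: partial_deriv_simps(2) partial_deriv_Const) (simp add: mult_ac)
    then show ?thesis by (simp only: inv mult_1)
  qed
  then have "partial_deriv z (\<Sum>n\<le>degree (poly_in z r). Const (inverse (of_nat (Suc n))) * c n * Var z ^ Suc n)
      = (\<Sum>n\<le>degree (poly_in z r). c n * Var z ^ n)"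
    by (simp only: partial_deriv_simps(6))
  also have "\<dots> = r"
    using poly_poly_in[of z r] by (simp add: poly_altdef c_def)
  finally show ?thesis by (rule that)
qed

lemma forall_3: "(\<forall>m::3. P m) \<longleftrightarrow> P 1 \<and> P 2 \<and> P 3"
proof -
  have "card {1, 2, 3 :: 3} = CARD(3)" by simp
  then have "(UNIV :: 3 set) = {1, 2, 3}" by (metis card_subset_eq finite subset_UNIV)
  then show ?thesis by (metis UNIV_I empty_iff insert_iff)
qed

text \<open>
  Induction on the degree in \<open>X\<^sub>i, X\<^sub>j\<close>. From \<open>f \<partial>\<^sub>i q + g \<partial>\<^sub>j q = 0\<close> and coprimality there is an \<open>r\<close> with
  \<open>\<partial>\<^sub>i q = g r\<close> and \<open>\<partial>\<^sub>j q = - f r\<close>, and \<open>r\<close> is again in the kernel. By induction \<open>r = R (T)\<close> with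
  \<open>T = g X\<^sub>i - f X\<^sub>j\<close>; if \<open>P\<close> is an antiderivative of \<open>R\<close> in the last variable, then \<open>P (T)\<close> has the same partial
  derivatives as \<open>q\<close>, and \<open>q - P (T)\<close> involves neither \<open>X\<^sub>i\<close> nor \<open>X\<^sub>j\<close>. Algebraic independence of \<open>T\<close> is also
  shown by differentiation: \<open>P (T) = 0\<close> entails \<open>P' (T) = 0\<close>.
\<close>

lemma kernel_coprime:
  fixes f g :: "(4, 'k::field_char_0) mpoly"
  assumes UNIV: "UNIV = {k, l, i, j}" and dist: "distinct [k, l, i, j]"
    and free_of: "free_of {i, j} f" "free_of {i, j} g" and cop: "coprime_split f g"
      and nz: "f \<noteq> 0 \<or> g \<noteq> 0"
  defines "w \<equiv> \<lambda>m. if m = i then f else if m = j then g else 0"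
  shows "is_polynomial_algebra TYPE(3) (Ker (deriv_along w))"
proof -
  have ij: "i \<noteq> j" "k \<noteq> i" "k \<noteq> j" "l \<noteq> i" "l \<noteq> j" "k \<noteq> l" using dist by auto
  define T where "T = g * Var i - f * Var j"
  define v where "v = (\<lambda>m::3. if m = 1 then Var k else if m = 2 then Var l else T)"
  define \<phi> where "\<phi> = subst v"
  have \<phi>: "ring_hom \<phi>" unfolding \<phi>_def by (rule ring_hom_eval_mpoly[OF ring_hom_Const])
  note \<phi>s = ring_hom_simps[OF \<phi>]
  have deriv_along: "deriv_along w q = f * partial_deriv i q + g * partial_deriv j q" for q
  proof (rule twisted_deriv_eqI[where F = "deriv_along w"])
    show "twisted_deriv (\<lambda>x. x) (\<lambda>q. f * partial_deriv i q + g * partial_deriv j q)"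
      by (rule twisted_derivI) (simp_all add: algebra_simps)
  qed (use ij in \<open>auto simp: twisted_deriv_deriv_along w_def\<close>)
  have coeffs: "partial_deriv i f = 0" "partial_deriv i g = 0" "partial_deriv j f = 0" "partial_deriv j g = 0"
    using free_of by (auto intro: partial_deriv_free_of)
  have chain_i: "partial_deriv i (\<phi> P) = g * \<phi> (partial_deriv 3 P)" for P
  proof (rule twisted_deriv_eqI[OF twisted_deriv_comp[OF twisted_deriv_partial_deriv \<phi>] twisted_deriv_cmult[OF twisted_deriv_comp2[OF twisted_deriv_partial_deriv \<phi>]]])
    have "\<forall>m. partial_deriv i (\<phi> (Var m)) = g * \<phi> (partial_deriv 3 (Var m))"
      using ij by (simp add: forall_3 \<phi>_def v_def T_def coeffs)
    then show "partial_deriv i (\<phi> (Var m)) = g * \<phi> (partial_deriv 3 (Var m))" for m by blast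
  qed (simp add: \<phi>_def)
  have chain_j: "partial_deriv j (\<phi> P) = - f * \<phi> (partial_deriv 3 P)" for P
  proof (rule twisted_deriv_eqI[OF twisted_deriv_comp[OF twisted_deriv_partial_deriv \<phi>] twisted_deriv_cmult[OF twisted_deriv_comp2[OF twisted_deriv_partial_deriv \<phi>]]])
    have "\<forall>m. partial_deriv j (\<phi> (Var m)) = - f * \<phi> (partial_deriv 3 (Var m))"
      using ij by (simp add: forall_3 \<phi>_def v_def T_def coeffs)
    then show "partial_deriv j (\<phi> (Var m)) = - f * \<phi> (partial_deriv 3 (Var m))" for m by blast
  qed (simp add: \<phi>_def)
  have set_zero_range: "set_zero {i, j} q \<in> range \<phi>" for q
  proof (induction q rule: mpoly_induct)
    case (Const c)
    have "set_zero {i, j} (Const c) = \<phi> (Const c)" by (simp add: \<phi>_def)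
    then show ?case by (rule range_eqI)
  next
    case (Var m)
    have "Var k \<in> range \<phi>" by (rule range_eqI[where x = "Var 1"]) (simp add: \<phi>_def v_def)
    moreover have "Var l \<in> range \<phi>" by (rule range_eqI[where x = "Var 2"]) (simp add: \<phi>_def v_def)
    moreover have "0 \<in> range \<phi>" by (rule range_eqI[where x = 0]) (simp add: \<phi>s)
    moreover have "m \<in> {k, l, i, j}" using UNIV by blast
    ultimately show ?case using ij by auto
  next
    case (add p q)
    then obtain P Q where "set_zero {i, j} p = \<phi> P" "set_zero {i, j} q = \<phi> Q" by (elim imageE)
    then have "set_zero {i, j} (p + q) = \<phi> (P + Q)" by (simp only: set_zero_simps \<phi>s)
    then show ?case by (rule range_eqI)
  next
    case (mult p q)
    then obtain P Q where "set_zero {i, j} p = \<phi> P" "set_zero {i, j} q = \<phi> Q" by (elim imageE)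
    then have "set_zero {i, j} (p * q) = \<phi> (P * Q)" by (simp only: set_zero_simps \<phi>s)
    then show ?case by (rule range_eqI)
  qed
  have kernel_range: "q \<in> range \<phi>" if "deriv_along w q = 0" for q
    using that
  proof (induction "degree (scale_vars {i, j} q)" arbitrary: q rule: less_induct)
    case less
    have "\<exists>r. partial_deriv i q = g * r \<and> partial_deriv j q = - f * r"
    proof (cases "f = 0")
      case True
      then have "g dvd partial_deriv i q" using cop by (simp add: coprime_split_def)
      then obtain r where "partial_deriv i q = g * r" by (rule dvdE)
      moreover have "partial_deriv j q = 0" using less.prems True nz by (simp add: deriv_along)
      ultimately show ?thesis using True by auto
    next
      case False
      have "f * partial_deriv i q + g * partial_deriv j q = 0" using less.prems
        by (simp add: deriv_along)
      then have eq: "g * partial_deriv j q = f * (- partial_deriv i q)" by (simp add: add_eq_0_iff)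
      then have "f dvd g * partial_deriv j q" by (rule dvdI)
      then have "f dvd partial_deriv j q" using cop unfolding coprime_split_def by blast
      then obtain r where r: "partial_deriv j q = f * r" by (rule dvdE)
      have "f * partial_deriv i q = f * (g * - r)" using eq by (simp add: r mult_ac)
      then have "partial_deriv i q = g * - r" using False unfolding mult_cancel_left by blast
      with r show ?thesis by (intro exI[of _ "- r"]) simp
    qed
    then obtain r where r: "partial_deriv i q = g * r" "partial_deriv j q = - f * r" by blast
    have deriv_along_partial_deriv: "deriv_along w (partial_deriv z q) = partial_deriv z (deriv_along w q)"
      if "z = i \<or> z = j" for z
      using that by (elim disjE) (simp_all add: deriv_along coeffs partial_deriv_commute[of i j])
    have deriv_along_fg: "deriv_along w f = 0" "deriv_along w g = 0" using coeffs
      by (simp_all add: deriv_along)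
    have "deriv_along w (g * r) = 0" unfolding r(1)[symmetric]
      using deriv_along_partial_deriv[of i] less.prems
      by simp
    then have "g * deriv_along w r = 0" by (simp add: deriv_along_fg)
    moreover have "deriv_along w (- f * r) = 0" unfolding r(2)[symmetric]
      using deriv_along_partial_deriv[of j] less.prems
      by simp
    then have "f * deriv_along w r = 0" by (simp add: deriv_along_fg)
    ultimately have deriv_along_r: "deriv_along w r = 0" using nz by auto
    have "r \<in> range \<phi>"
    proof (cases "r = 0")
      case True
      then have "r = \<phi> 0" by (simp only: \<phi>s)
      then show ?thesis by (rule range_eqI)
    next
      case False
      have "degree (scale_vars {i, j} r) < degree (scale_vars {i, j} q)"
      proof (cases "f = 0")
        case True
        then have "g * r \<noteq> 0" using nz False by simp
        moreover have "degree (scale_vars {i, j} (g * r)) = degree (scale_vars {i, j} g) + degree (scale_vars {i, j} r)"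
          using calculation by (simp add: degree_mult_eq)
        ultimately show ?thesis using degree_partial_deriv_less[of i "{i, j}" q] r by simp
      next
        case f: False
        then have nz': "- f * r \<noteq> 0" using False by simp
        moreover have "degree (scale_vars {i, j} (- f * r)) = degree (scale_vars {i, j} (- f)) + degree (scale_vars {i, j} r)"
          using nz' unfolding scale_vars_simps(3) by (intro degree_mult_eq) auto
        ultimately show ?thesis using degree_partial_deriv_less[of j "{i, j}" q] r by simp
      qed
      then show ?thesis by (rule less.hyps[OF _ deriv_along_r])
    qed
    then obtain R where R: "r = \<phi> R" by (rule imageE)
    obtain P where P: "partial_deriv 3 P = R" by (rule antiderivative)
    have pd0: "partial_deriv i (q - \<phi> P) = 0" "partial_deriv j (q - \<phi> P) = 0"
      by (simp_all add: chain_i chain_j P r R)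
    have "free_of {i, j} (q - \<phi> P)"
      by (rule free_of_insert[OF partial_deriv_eq_0_imp_free_of[OF pd0(1)] partial_deriv_eq_0_imp_free_of[OF pd0(2)]])
    then have "q - \<phi> P \<in> range \<phi>" using set_zero_range[of "q - \<phi> P"] by (simp only: free_of_def)
    then obtain Q where "q - \<phi> P = \<phi> Q" by (rule imageE)
    then have "q = \<phi> (Q + P)" by (simp add: \<phi>s algebra_simps)
    then show ?case by (rule range_eqI)
  qed
  have inj: "P = 0" if "\<phi> P = 0" for P
    using that
  proof (induction "degree (poly_in 3 P)" arbitrary: P rule: less_induct)
    case less
    have "g * \<phi> (partial_deriv 3 P) = 0" "- f * \<phi> (partial_deriv 3 P) = 0"
      unfolding chain_i[symmetric] chain_j[symmetric] less.prems by simp_all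
    then have \<phi>_partial_deriv: "\<phi> (partial_deriv 3 P) = 0" using nz by auto
    have partial_deriv: "partial_deriv 3 P = 0"
    proof (rule ccontr)
      assume *: "partial_deriv 3 P \<noteq> 0"
      then have "pderiv (poly_in 3 P) \<noteq> 0" by (simp add: poly_in_partial_deriv[symmetric])
      then have "degree (poly_in 3 P) \<noteq> 0" by (simp add: pderiv_eq_0_iff)
      then have "degree (poly_in 3 (partial_deriv 3 P)) < degree (poly_in 3 P)"
        by (simp add: poly_in_partial_deriv degree_pderiv)
      from less.hyps[OF this \<phi>_partial_deriv] * show False by simp
    qed
    \<comment> \<open>A polynomial without the last variable is recovered from its image by renaming \<open>X\<^sub>k\<close> and \<open>X\<^sub>l\<close> back.\<close>
    define \<chi>
      where "\<chi> = subst (\<lambda>m::4. if m = k then Var (1::3) else if m = l then Var 2 else 0 :: (3, 'k) mpoly)"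
    have \<chi>: "ring_hom \<chi>" unfolding \<chi>_def by (rule ring_hom_eval_mpoly[OF ring_hom_Const])
    have "\<chi> (\<phi> P) = set_zero {3} P"
    proof (rule ring_hom_eqI[where F = "\<lambda>P. \<chi> (\<phi> P)"])
      show "ring_hom (\<lambda>P. \<chi> (\<phi> P))" by (rule ring_hom_comp[OF \<chi> \<phi>])
      have "\<forall>m. \<chi> (\<phi> (Var m)) = set_zero {3} (Var m)"
        using ij by (simp add: forall_3 \<phi>_def v_def T_def \<chi>_def)
      then show "\<chi> (\<phi> (Var m)) = set_zero {3} (Var m)" for m by blast
    qed (auto simp: ring_hom_set_zero \<chi>_def \<phi>_def)
    moreover have "set_zero {3} P = P" using partial_deriv_eq_0_imp_free_of[OF partial_deriv]
      by (simp add: free_of_def)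
    ultimately show "P = 0" using less.prems ring_hom_simps(4)[OF \<chi>] by simp
  qed
  have "inj \<phi>"
  proof (rule injI)
    fix P Q assume "\<phi> P = \<phi> Q"
    then have "\<phi> (P - Q) = 0" by (simp add: \<phi>s)
    then show "P = Q" using inj[of "P - Q"] by simp
  qed
  moreover have "range \<phi> = Ker (deriv_along w)"
    using kernel_range by (auto simp: Ker_def deriv_along chain_i chain_j algebra_simps)
  ultimately have "bij_betw \<phi> UNIV (Ker (deriv_along w))" by (simp add: bij_betw_def)
  moreover have "K_algebra_hom \<phi>"
    by (simp add: K_algebra_hom_def \<phi>s) (simp add: \<phi>_def)
  ultimately show ?thesis unfolding is_polynomial_algebra_def by blast
qed

lemma irreducible_deriv_along_factor:
  assumes "irreducible_derivation (deriv_along w)" "\<And>l. w l = e * w' l"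
  shows "e dvd 1"
proof -
  have "w = (\<lambda>l. e * w' l)" using assms(2) by auto
  then have "range (deriv_along w) \<subseteq> range (\<lambda>x. e * x)" by (auto simp: deriv_along_cmult)
  with assms(1) show ?thesis unfolding reducible_derivation_def by blast
qed

text \<open>
  A value \<open>w\<^sub>i\<close> or \<open>w\<^sub>j\<close> of positive degree in \<open>X\<^sub>i, X\<^sub>j\<close> has a top form that is a relation between \<open>w\<^sub>i\<close> and
  \<open>w\<^sub>j\<close>. So \<open>w\<^sub>i = d a\<close> and \<open>w\<^sub>j = d b\<close> with \<open>a, b\<close> in \<open>S\<close>, and \<open>d\<close> is a unit by irreducibility. The greatest
  common divisor \<open>e\<close> of \<open>w\<^sub>i\<close> and \<open>w\<^sub>j\<close> can be cancelled without changing the kernel.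
\<close>

lemma kernel_two_variables:
  fixes w :: "4 \<Rightarrow> (4, 'k::field_char_0) mpoly"
  assumes UNIV: "UNIV = {k, l, i, j}" and dist: "distinct [k, l, i, j]"
    and supp: "w k = 0" "w l = 0" and quasi_transl: "quasi_transl w"
      and irred: "irreducible_derivation (deriv_along w)"
  shows "is_polynomial_algebra TYPE(3) (Ker (deriv_along w))"
proof -
  let ?N = "{i, j}"
  have supp': "w m = 0" if "m \<notin> ?N" for m
  proof -
    have "m \<in> {k, l, i, j}" using UNIV by blast
    with that supp show ?thesis by auto
  qed
  have ij: "i \<noteq> j" using dist by simp
  have commensurable: "commensurable ?N (w i) (w j)"
  proof (cases "\<forall>m\<in>?N. free_of ?N (w m)")
    case True
    then show ?thesis by (intro commensurable_if_free_of) auto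
  next
    case False
    then obtain m where "\<not> free_of ?N (w m)" by blast
    then have m: "degree (scale_vars ?N (w m)) > 0" by (simp add: free_of_iff_degree)
    then have nz: "w m \<noteq> 0" by auto
    define v where "v = (\<lambda>l. if l \<in> ?N then w l else Var l)"
    have "replace_vars ?N w (lead_coeff (scale_vars ?N (w m))) = 0"
      by (rule replace_vars_top_eq_0[OF quasi_transl _ supp' m])
        (use quasi_transl in \<open>simp add: quasi_transl_def\<close>)
    then have rel: "subst v (lead_coeff (scale_vars ?N (w m))) = 0"
      by (simp add: replace_vars_def v_def)
    have "free_of {} p" for p :: "(4, 'k) mpoly" by (simp add: free_of_def set_zero_def subst_Var)
    then have "commensurable ?N (v i) (v j)"
      using ij nz
        by (intro two_variable_relation[OF _ _ _ _ homogeneous_coeff_scale_vars _ _ rel])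
          (auto simp: v_def)
    then show ?thesis by (simp add: v_def)
  qed
  then obtain d a b where dab: "w i = d * a" "w j = d * b" "free_of ?N a" "free_of ?N b"
    unfolding commensurable_def by blast
  have "d dvd 1"
    by (rule irreducible_deriv_along_factor[OF irred, of _ "\<lambda>m. if m = i then a else if m = j then b else 0"])
      (use dab supp' in auto)
  then have free_of: "free_of ?N (w i)" "free_of ?N (w j)"
    using dab unit_free_of by auto
  have nz: "w i \<noteq> 0 \<or> w j \<noteq> 0"
  proof (rule ccontr)
    assume "\<not> ?thesis"
    \<comment> \<open>The zero derivation is reducible, with the non-unit \<open>0\<close> as divisor.\<close>
    then have "w m = 0 * 0" for m using supp'[of m] by auto
    then have "(0 :: (4, 'k) mpoly) dvd 1" by (rule irreducible_deriv_along_factor[OF irred])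
    then show False by simp
  qed
  then obtain e f g where efg: "w i = e * f" "w j = e * g" "coprime_split f g"
    using mpoly_gcd_factorization[of "w i" "w j"] by blast
  define w' where "w' = (\<lambda>m. if m = i then f else if m = j then g else 0)"
  have w: "w = (\<lambda>m. e * w' m)" using efg supp' by (auto simp: w'_def)
  have e: "e \<noteq> 0" using nz efg by auto
  have "free_of ?N f"
  proof (cases "f = 0")
    case False
    then show ?thesis using free_of_factor[of ?N f e] free_of e by (simp add: efg mult.commute)
  qed simp
  moreover have "free_of ?N g"
  proof (cases "g = 0")
    case False
    then show ?thesis using free_of_factor[of ?N g e] free_of e by (simp add: efg mult.commute)
  qed simp
  ultimately have "is_polynomial_algebra TYPE(3) (Ker (deriv_along w'))"
    unfolding w'_def using nz efg by (intro kernel_coprime[OF UNIV dist]) auto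
  moreover have "Ker (deriv_along w) = Ker (deriv_along w')"
    using e by (simp add: Ker_def w deriv_along_cmult)
  ultimately show ?thesis by simp
qed

section \<open>Elementary coordinate changes\<close>

text \<open>
  Conjugating the derivation by the automorphism \<open>u\<close> of the polynomial ring rewrites it in the
  coordinates \<open>u\<^sub>l\<close>.
\<close>

lemma polynomial_kernel_transport:
  fixes u u' :: "'n::linorder \<Rightarrow> ('n, 'k::idom) mpoly"
  assumes inv: "\<And>l. subst u' (u l) = Var l" "\<And>l. subst u (u' l) = Var l"
    and irred: "irreducible_derivation (deriv_along w)"
  defines "w' \<equiv> \<lambda>l. subst u' (deriv_along w (u l))"
  shows "deriv_along w' q = subst u' (deriv_along w (subst u q))"
    and "irreducible_derivation (deriv_along w')"
    and "is_polynomial_algebra TYPE('m::finite) (Ker (deriv_along w')) \<Longrightarrow> is_polynomial_algebra TYPE('m) (Ker (deriv_along w))"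
proof -
  have u'u: "subst u' (subst u q) = q" and uu': "subst u (subst u' q) = q" for q
    by (simp_all add: subst_subst inv subst_Var)
  show deriv_along: "deriv_along w' q = subst u' (deriv_along w (subst u q))" for q
  proof (rule twisted_deriv_eqI[OF twisted_deriv_deriv_along])
    show "twisted_deriv (\<lambda>x. x) (\<lambda>q. subst u' (deriv_along w (subst u q)))"
      by (rule twisted_derivI) (simp_all add: u'u)
  qed (simp_all add: w'_def)
  show "irreducible_derivation (deriv_along w')"
    unfolding reducible_derivation_def
  proof (intro notI, elim exE conjE)
    fix b assume b: "\<not> b dvd 1" "range (deriv_along w') \<subseteq> range (\<lambda>x. b * x)"
    have "deriv_along w q \<in> range (\<lambda>x. subst u b * x)" for q
    proof -
      obtain x where "deriv_along w' (subst u' q) = b * x" using b(2) by blast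
      then have "subst u' (deriv_along w q) = b * x" unfolding deriv_along uu' .
      then have "subst u (subst u' (deriv_along w q)) = subst u (b * x)" by (rule arg_cong)
      then have "subst u (subst u' (deriv_along w q)) = subst u b * subst u x"
        by (simp only: subst_simps)
      then show ?thesis unfolding uu' by (rule range_eqI)
    qed
    then have "subst u b dvd 1" using irred unfolding reducible_derivation_def by blast
    then obtain c where "1 = subst u b * c" by (rule dvdE)
    then have "subst u' 1 = subst u' (subst u b * c)" by simp
    then have "1 = b * subst u' c" by (simp only: subst_simps u'u)
    then have "b dvd 1" by (rule dvdI)
    with b(1) show False by contradiction
  qed
  assume "is_polynomial_algebra TYPE('m) (Ker (deriv_along w'))"
  then obtain \<phi> :: "('m, 'k) mpoly \<Rightarrow> ('n, 'k) mpoly"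
    where \<phi>: "K_algebra_hom \<phi>" "bij_betw \<phi> UNIV (Ker (deriv_along w'))"
    unfolding is_polynomial_algebra_def by blast
  have "bij_betw (subst u) (Ker (deriv_along w')) (Ker (deriv_along w))"
  proof (rule bij_betwI[where g = "subst u'"])
    show "subst u \<in> Ker (deriv_along w') \<rightarrow> Ker (deriv_along w)"
    proof
      fix q assume "q \<in> Ker (deriv_along w')"
      then have "subst u (subst u' (deriv_along w (subst u q))) = subst u 0"
        by (simp add: Ker_def deriv_along)
      then show "subst u q \<in> Ker (deriv_along w)" unfolding uu' by (simp add: Ker_def)
    qed
    show "subst u' \<in> Ker (deriv_along w) \<rightarrow> Ker (deriv_along w')"
      by (auto simp: Ker_def deriv_along uu')
  qed (simp_all add: uu' u'u)
  with \<phi>(2) have "bij_betw (\<lambda>q. subst u (\<phi> q)) UNIV (Ker (deriv_along w))"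
    using bij_betw_trans[of \<phi> UNIV _ "subst u"] by (simp add: comp_def)
  moreover have "K_algebra_hom (\<lambda>q. subst u (\<phi> q))"
    using \<phi>(1) by (simp add: K_algebra_hom_def)
  ultimately show "is_polynomial_algebra TYPE('m) (Ker (deriv_along w))"
    unfolding is_polynomial_algebra_def by blast
qed

text \<open>
  The subring \<open>K[X\<^sub>1]\<close> as the image of the univariate polynomials, which have division with
  remainder.
\<close>

definition poly_X1 :: "'k::field poly \<Rightarrow> (4, 'k) mpoly"
  where "poly_X1 = lift_hom Const (Var 1)"

lemma ring_hom_poly_X1: "ring_hom poly_X1"
  unfolding poly_X1_def by (rule ring_hom_lift_hom[OF ring_hom_Const])

lemmas poly_X1_simps [simp] = ring_hom_simps[OF ring_hom_poly_X1]

lemma poly_X1_Const: "poly_X1 [:c:] = Const c"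
  and poly_X1_Var: "poly_X1 [:0, 1:] = Var 1"
  by (simp_all add: poly_X1_def lift_hom_simps[OF ring_hom_Const])

lemma poly_X1_eq_0_iff [simp]: "poly_X1 a = 0 \<longleftrightarrow> a = 0"
proof
  define F :: "(4, 'a) mpoly \<Rightarrow> 'a poly" where "F = eval_mpoly (\<lambda>c. [:c:]) (\<lambda>_. [:0, 1:])"
  have F: "ring_hom F" unfolding F_def by (rule ring_hom_eval_mpoly[OF ring_hom_pCons])
  have "F (poly_X1 a) = a"
    by (rule poly_ring_hom_eqI[OF ring_hom_comp[OF F ring_hom_poly_X1] ring_hom_id])
      (simp_all add: poly_X1_Const poly_X1_Var F_def eval_mpoly_Const[OF ring_hom_pCons] eval_mpoly_Var[OF ring_hom_pCons])
  moreover assume "poly_X1 a = 0"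
  ultimately show "a = 0" by (simp add: ring_hom_simps[OF F])
qed simp

lemma subst_poly_X1:
  assumes "u 1 = Var 1"
  shows "subst u (poly_X1 a) = poly_X1 a"
  by (rule poly_ring_hom_eqI[OF ring_hom_comp[OF ring_hom_eval_mpoly[OF ring_hom_Const] ring_hom_poly_X1] ring_hom_poly_X1])
    (simp_all add: poly_X1_Const poly_X1_Var assms)

lemma index_4_cases: "i = 1 \<or> i = 2 \<or> i = 3 \<or> i = (4::4)"
  using index_UNIV_4 by blast

lemma free_of_poly_X1: "free_of {2, 3, 4} (poly_X1 a)"
  unfolding free_of_def set_zero_def by (rule subst_poly_X1) simp

lemma eq_poly_X1_if_free_of:
  assumes "free_of {2, 3, 4} p"
  obtains a where "p = poly_X1 a"
proof -
  have "set_zero {2, 3, 4} p \<in> range poly_X1"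
  proof (induction p rule: mpoly_induct)
    case (Const c)
    show ?case by (rule range_eqI[of _ _ "[:c:]"]) (simp add: poly_X1_Const)
  next
    case (Var i)
    show ?case
    proof (cases "i = 1")
      case True
      then show ?thesis by (intro range_eqI[of _ _ "[:0, 1:]"]) (simp add: poly_X1_Var)
    next
      case False
      then have "set_zero {2, 3, 4} (Var i) = poly_X1 0" using index_4_cases[of i] by auto
      then show ?thesis by (rule range_eqI)
    qed
  next
    case (add p q)
    then obtain a b where "set_zero {2, 3, 4} p = poly_X1 a" "set_zero {2, 3, 4} q = poly_X1 b"
      by (elim imageE)
    then have "set_zero {2, 3, 4} (p + q) = poly_X1 (a + b)"
      by (simp only: set_zero_simps poly_X1_simps)
    then show ?case by (rule range_eqI)
  next
    case (mult p q)
    then obtain a b where "set_zero {2, 3, 4} p = poly_X1 a" "set_zero {2, 3, 4} q = poly_X1 b"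
      by (elim imageE)
    then have "set_zero {2, 3, 4} (p * q) = poly_X1 (a * b)"
      by (simp only: set_zero_simps poly_X1_simps)
    then show ?case by (rule range_eqI)
  qed
  then obtain a where "set_zero {2, 3, 4} p = poly_X1 a" by (rule imageE)
  moreover have "set_zero {2, 3, 4} p = p" using assms unfolding free_of_def .
  ultimately have "p = poly_X1 a" by simp
  then show ?thesis by (rule that)
qed

text \<open>
  The Euclidean algorithm on the coefficients of the relation. If \<open>a\<^sub>j = a\<^sub>i q + r\<close>, then
  \<open>a\<^sub>i w\<^sub>i + a\<^sub>j w\<^sub>j = a\<^sub>i (w\<^sub>i + q w\<^sub>j) + r w\<^sub>j\<close>, and \<open>w\<^sub>i + q w\<^sub>j\<close> is the value of the derivation at the new
  coordinate \<open>X\<^sub>i + q X\<^sub>j\<close>. Once a single coefficient is left, the corresponding value is zero.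
\<close>

lemma polynomial_kernel_of_relation:
  fixes w :: "4 \<Rightarrow> (4, 'k::field_char_0) mpoly"
  assumes "w 1 = 0" "quasi_transl w" "irreducible_derivation (deriv_along w)"
    and "l \<in> {2, 3, 4}" "a l \<noteq> 0" "(\<Sum>l\<in>{2, 3, 4}. poly_X1 (a l) * w l) = 0"
  shows "is_polynomial_algebra TYPE(3) (Ker (deriv_along w))"
  using assms
proof (induction "\<Sum>l\<in>{2, 3, 4 :: 4}. if a l = 0 then 0 else Suc (degree (a l))" arbitrary: a w l rule: less_induct)
  case (less a w l)
  let ?N = "{2, 3, 4} :: 4 set"
  let ?size = "\<lambda>a :: 4 \<Rightarrow> 'k poly. \<Sum>l\<in>?N. if a l = 0 then 0 else Suc (degree (a l))"
  show ?case
  proof (cases "\<exists>i\<in>?N. i \<noteq> l \<and> a i \<noteq> 0")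
    case False
    have "(\<Sum>i\<in>?N. poly_X1 (a i) * w i) = (\<Sum>i\<in>{l}. poly_X1 (a i) * w i)"
      by (rule sum.mono_neutral_right) (use False less.prems(4) in auto)
    then have "poly_X1 (a l) * w l = 0" using less.prems(6) by simp
    then have wl: "w l = 0" using less.prems(5) by simp
    obtain i j where "UNIV = {1, l, i, j}" "distinct [1, l, i, j]"
    proof -
      consider "l = 2" | "l = 3" | "l = 4" using less.prems(4) by blast
      then show ?thesis
      proof cases
        case 1
        then show ?thesis using that[of 3 4] index_UNIV_4 index_distinct_4 by simp
      next
        case 2
        then show ?thesis using that[of 2 4] index_UNIV_4 index_distinct_4
          by (simp add: insert_commute)
      next
        case 3
        then show ?thesis using that[of 2 3] index_UNIV_4 index_distinct_4
          by (simp add: insert_commute)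
      qed
    qed
    from kernel_two_variables[OF this less.prems(1) wl less.prems(2,3)] show ?thesis .
  next
    case True
    then obtain m where m: "m \<in> ?N" "m \<noteq> l" "a m \<noteq> 0" by blast
    obtain i j where ij: "i \<in> ?N" "j \<in> ?N" "i \<noteq> j" "a i \<noteq> 0" "a j \<noteq> 0" "degree (a i) \<le> degree (a j)"
    proof (cases "degree (a m) \<le> degree (a l)")
      case True
      then show ?thesis using that[of m l] m less.prems(4,5) by simp
    next
      case False
      then show ?thesis using that[of l m] m less.prems(4,5) by simp
    qed
    have i1: "i \<noteq> 1" using ij(1) index_distinct_4 by auto
    define q where "q = a j div a i"
    define r where "r = a j mod a i"
    have aj: "a j = a i * q + r" unfolding q_def r_def by simp
    define u where "u = (\<lambda>l. if l = i then Var i + poly_X1 q * Var j else Var l)"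
    define u' where "u' = (\<lambda>l. if l = i then Var i - poly_X1 q * Var j else Var l)"
    have poly_X1_u: "subst u (poly_X1 b) = poly_X1 b" "subst u' (poly_X1 b) = poly_X1 b" for b
      using i1 by (auto intro!: subst_poly_X1 simp: u_def u'_def)
    have u: "u l = (if l = i then Var i + poly_X1 q * Var j else Var l)"
      and u': "u' l = (if l = i then Var i - poly_X1 q * Var j else Var l)" for l
      by (simp_all add: u_def u'_def)
    have inv: "subst u' (u l) = Var l" "subst u (u' l) = Var l" for l
      using ij(3) by (simp_all add: u u' poly_X1_u)
    have uu': "subst u (subst u' q) = q" for q
      by (simp add: subst_subst inv subst_Var)
    define w' where "w' = (\<lambda>l. subst u' (deriv_along w (u l)))"
    note transport = polynomial_kernel_transport[OF inv less.prems(3), folded w'_def]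
    have deriv_along_poly_X1: "deriv_along w (poly_X1 b) = 0" for b
    proof (rule deriv_along_free_of[OF free_of_poly_X1])
      fix l :: 4 assume "l \<notin> ?N"
      then have "l = 1" using index_4_cases[of l] by auto
      then show "w l = 0" using less.prems(1) by simp
    qed
    have deriv_along_u: "deriv_along w (u l) = w l + (if l = i then poly_X1 q * w j else 0)" for l
      by (simp add: u deriv_along_poly_X1)
    define a' where "a' = a(j := r)"
    have "is_polynomial_algebra TYPE(3) (Ker (deriv_along w'))"
    proof (rule less.hyps[of a'])
      have "r = 0 \<or> degree r < degree (a i)"
        unfolding r_def using ij(4) by (rule degree_mod_less)
      then have "(if r = 0 then 0 else Suc (degree r)) < (if a j = 0 then 0 else Suc (degree (a j)))"
        using ij by auto
      then show "?size a' < ?size a"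
        by (intro sum_strict_mono_ex1) (use ij in \<open>auto simp: a'_def\<close>)
      show "w' 1 = 0" using i1 less.prems(1) by (simp add: w'_def u)
      show "quasi_transl w'"
        unfolding quasi_transl_def transport(1) using less.prems(2)
        by (auto simp: w'_def uu' deriv_along_u deriv_along_poly_X1 quasi_transl_def)
      show "irreducible_derivation (deriv_along w')" by (rule transport(2))
      show "i \<in> ?N" by (rule ij)
      show "a' i \<noteq> 0" using ij by (simp add: a'_def)
      have "poly_X1 (a' l) * deriv_along w (u l) = poly_X1 (a l) * w l + (if l = i then poly_X1 (a i) * poly_X1 q * w j else 0)
          - (if l = j then poly_X1 (a i) * poly_X1 q * w j else 0)" for l
        using ij(3) by (auto simp: deriv_along_u a'_def aj algebra_simps)
      then have "(\<Sum>l\<in>?N. poly_X1 (a' l) * deriv_along w (u l)) = 0"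
        using ij(1,2) less.prems(6) 
        by (simp only: sum.distrib sum_subtractf sum.delta finite.intros if_True add_0 diff_self)
      then have "subst u' (\<Sum>l\<in>?N. poly_X1 (a' l) * deriv_along w (u l)) = 0" by simp
      then show "(\<Sum>l\<in>?N. poly_X1 (a' l) * w' l) = 0" 
        by (simp only: subst_simps poly_X1_u w'_def)
    qed
    then show ?thesis by (rule transport(3))
  qed
qed

theorem corollary3p8:
  fixes D :: "(4, 'k::field_char_0) mpoly \<Rightarrow> (4, 'k) mpoly"
  assumes "K_derivation D"
    and "locally_nilpotent D"
    and "irreducible_derivation D"
    and "D (Var 1) = 0"
    and "\<forall>i\<in>{2, 3, 4}. (D ^^ 2) (Var i) = 0"
  shows "is_polynomial_algebra TYPE(3) (Ker D)"
proof -
  define w where "w = (\<lambda>l. D (Var l))"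
  have D: "D = deriv_along w" unfolding w_def by (rule K_derivation_eq_deriv_along[OF assms(1)])
  have w1: "w 1 = 0" using assms(4) by (simp add: w_def)
  have supp: "w l = 0" if "l \<notin> {2, 3, 4}" for l
    using that w1 index_4_cases[of l] by auto
  have quasi_transl: "quasi_transl w"
    unfolding quasi_transl_def
  proof
    fix l
    show "deriv_along w (w l) = 0"
    proof (cases "l = 1")
      case False
      then have "l \<in> {2, 3, 4}" using index_4_cases[of l] by auto
      then have "D (D (Var l)) = 0" using assms(5) by (auto simp: numeral_2_eq_2)
      then show ?thesis by (simp add: D)
    qed (simp add: w1)
  qed
  have "distinct [2, 3, 4 :: 4]" using index_distinct_4 by simp
  then obtain b where b: "\<And>l. free_of {2, 3, 4} (b l)" "\<exists>l\<in>{2, 3, 4}. b l \<noteq> 0"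
      "(\<Sum>l\<in>{2, 3, 4}. b l * w l) = 0"
    using quasi_transl_linear_relation[of 2 3 4 w, OF _ _ _ supp quasi_transl] by auto
  have "\<exists>a. b l = poly_X1 a" for l using eq_poly_X1_if_free_of[OF b(1)] by metis
  then obtain a where a: "\<And>l. b l = poly_X1 (a l)" by metis
  from b(2) obtain l where "l \<in> {2, 3, 4}" "a l \<noteq> 0" unfolding a by auto
  then show ?thesis
    using polynomial_kernel_of_relation[of w l a] w1 quasi_transl assms(3) b(3) unfolding a D
      by blast
qed

end
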